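(* Let $k$ be a commutative ring with $2\in k^\times$, let $A$ be a commutative $k$-algebra with an involution $\theta$, and let $t_0\in k^\times$. Define involutions on $k[x]/(x^2-t_0)$ and $A[x]/(x^2-t_0)$ by $$\sigma_k: a+bx\mapsto a-bx\ (a,b\in k),\qquad \sigma_A: a+bx\mapsto \theta(a)-\theta(b)x\ (a,b\in A).$$ (1) The canonical homomorphism $\varphi:k[x]/(x^2-t_0)\to A[x]/(x^2-t_0)$ satisfies $\varphi\circ\sigma_k=\sigma_A\circ\varphi$. Equivalently, $\sigma_A(\varphi(\alpha)\beta)=\varphi(\sigma_k(\alpha))\sigma_A(\beta)$ for all $\alpha\in k[x]/(x^2-t_0)$ and $\beta\in A[x]/(x^2-t_0)$. (2) There is an isomorphism of $k$-algebras from $\mathbf{A}_{t_0}$ onto the fixed point subalgebra of $A[x]/(x^2-t_0)$ under $\sigma_A$. Moreover, its scalar extension gives rise to an isomorphism $\mathbf{A}_{t_0}[x]/(x^2-t_0)\cong A[x]/(x^2-t_0)$. (3) If the equation $x^2=t_0$ admits a solution in $k$, then there is a $k$-algebra isomorphism $\mathbf{A}_{t_0}\cong A$.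
   Context: An involution of a commutative $k$-algebra $A$ is a $k$-algebra automorphism $\theta$ with $\theta\circ\theta=\mathrm{id}_A$. Put $A^{\theta}=\{a\in A:\theta(a)=a\}$ and $A^{-\theta}=\{a\in A:\theta(a)=-a\}$. The contraction algebra $\mathbf{A}$ of $(A,\theta)$ is the $k[t]$-subalgebra of the Laurent polynomial ring $A[\sqrt{t}^{\pm1}]$ (in the variable $\sqrt t$, with $t=(\sqrt t)^2$) generated by $A^\theta$ and $\frac{1}{\sqrt t}A^{-\theta}$. For $t_0\in k$, $\mathbf{A}_{t_0}=\mathbf{A}/(t-t_0)$. *)

theory Defs
  imports "HOL-Algebra.UnivPoly" "HOL-Algebra.QuotRing" "HOL-Algebra.Subrings"
begin

section \<open>Algebras, homomorphisms and involutions\<close>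

text \<open>
  A \<open>k\<close>-algebra is a record \<open>M\<close> with \<^term>\<open>algebra k M\<close>. The algebras below
  are rings \<open>S\<close> equipped with a homomorphism \<open>h\<close> from the base ring, which acts by
  \<open>c \<odot> x = h c \<otimes> x\<close>.
\<close>

definition alg_via :: "('c \<Rightarrow> 'b) \<Rightarrow> ('b, 'n) ring_scheme \<Rightarrow> ('c, 'b) module" where
  "alg_via h S =
     \<lparr>carrier = carrier S, mult = mult S, one = one S, zero = zero S, add = add S,
      smult = (\<lambda>c x. h c \<otimes>\<^bsub>S\<^esub> x)\<rparr>"

definition self_alg :: "('c, 'm) ring_scheme \<Rightarrow> ('c, 'c) module" where
  "self_alg k = alg_via (\<lambda>c. c) k"

definition base_map :: "('c, 'a, 'n) module_scheme \<Rightarrow> 'c \<Rightarrow> 'a" where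
  "base_map M c = c \<odot>\<^bsub>M\<^esub> \<one>\<^bsub>M\<^esub>"

definition alg_hom ::
  "('c, 'm) ring_scheme \<Rightarrow> ('c, 'a, 'n) module_scheme \<Rightarrow> ('c, 'b, 'o) module_scheme
    \<Rightarrow> ('a \<Rightarrow> 'b) set" where
  "alg_hom k M N = {h \<in> ring_hom M N.
     \<forall>c\<in>carrier k. \<forall>x\<in>carrier M. h (c \<odot>\<^bsub>M\<^esub> x) = c \<odot>\<^bsub>N\<^esub> h x}"

definition alg_iso ::
  "('c, 'm) ring_scheme \<Rightarrow> ('c, 'a, 'n) module_scheme \<Rightarrow> ('c, 'b, 'o) module_scheme
    \<Rightarrow> ('a \<Rightarrow> 'b) set" where
  "alg_iso k M N = {h \<in> alg_hom k M N. bij_betw h (carrier M) (carrier N)}"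

definition involution ::
  "('c, 'm) ring_scheme \<Rightarrow> ('c, 'a, 'n) module_scheme \<Rightarrow> ('a \<Rightarrow> 'a) \<Rightarrow> bool" where
  "involution k M \<theta> \<longleftrightarrow> \<theta> \<in> alg_iso k M M \<and> (\<forall>x\<in>carrier M. \<theta> (\<theta> x) = x)"

definition fixed_set :: "('a, 'n) ring_scheme \<Rightarrow> ('a \<Rightarrow> 'a) \<Rightarrow> 'a set" where
  "fixed_set M \<theta> = {a \<in> carrier M. \<theta> a = a}"

definition anti_fixed_set :: "('a, 'n) ring_scheme \<Rightarrow> ('a \<Rightarrow> 'a) \<Rightarrow> 'a set" where
  "anti_fixed_set M \<theta> = {a \<in> carrier M. \<theta> a = \<ominus>\<^bsub>M\<^esub> a}"

definition fixed_alg :: "('c, 'a, 'n) module_scheme \<Rightarrow> ('a \<Rightarrow> 'a) \<Rightarrow> ('c, 'a, 'n) module_scheme"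
  where "fixed_alg M \<theta> = M\<lparr>carrier := fixed_set M \<theta>\<rparr>"

definition is_subalg ::
  "('c, 'm) ring_scheme \<Rightarrow> ('c, 'a, 'n) module_scheme \<Rightarrow> 'a set \<Rightarrow> bool" where
  "is_subalg R M S \<longleftrightarrow> subring S M \<and> (\<forall>c\<in>carrier R. \<forall>x\<in>S. c \<odot>\<^bsub>M\<^esub> x \<in> S)"

definition generated_subalg ::
  "('c, 'm) ring_scheme \<Rightarrow> ('c, 'a, 'n) module_scheme \<Rightarrow> 'a set \<Rightarrow> 'a set" where
  "generated_subalg R M X = \<Inter>{S. is_subalg R M S \<and> X \<subseteq> S}"

section \<open>The contraction algebra\<close>

text \<open>
  Laurent polynomials in the variable \<open>\<surd>t\<close>: \<open>f n\<close> is the coefficient of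
  \<open>(\<surd>t)\<^sup>n\<close>. In particular, \<open>t\<close> is the monomial of exponent 2.
\<close>

definition laurent_ring :: "('a, 'n) ring_scheme \<Rightarrow> (int \<Rightarrow> 'a) ring" where
  "laurent_ring M =
     \<lparr>carrier = {f. (\<forall>n. f n \<in> carrier M) \<and> finite {n. f n \<noteq> \<zero>\<^bsub>M\<^esub>}},
      mult = (\<lambda>f g n. \<Oplus>\<^bsub>M\<^esub>i\<in>{i. f i \<noteq> \<zero>\<^bsub>M\<^esub>}. f i \<otimes>\<^bsub>M\<^esub> g (n - i)),
      one = (\<lambda>n. if n = 0 then \<one>\<^bsub>M\<^esub> else \<zero>\<^bsub>M\<^esub>),
      zero = (\<lambda>n. \<zero>\<^bsub>M\<^esub>),
      add = (\<lambda>f g n. f n \<oplus>\<^bsub>M\<^esub> g n)\<rparr>"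

definition laurent_monom :: "('a, 'n) ring_scheme \<Rightarrow> 'a \<Rightarrow> int \<Rightarrow> (int \<Rightarrow> 'a)" where
  "laurent_monom M a n = (\<lambda>i. if i = n then a else \<zero>\<^bsub>M\<^esub>)"

text \<open>The Laurent polynomials over \<open>M\<close> as an algebra over \<open>k[t]\<close> = \<^term>\<open>UP k\<close>.\<close>

definition laurent_alg ::
  "('c, 'm) ring_scheme \<Rightarrow> ('c, 'a, 'n) module_scheme \<Rightarrow> (nat \<Rightarrow> 'c, int \<Rightarrow> 'a) module" where
  "laurent_alg k M =
     alg_via
       (eval k (laurent_ring M) (\<lambda>c. laurent_monom M (base_map M c) 0) (laurent_monom M \<one>\<^bsub>M\<^esub> 2))
       (laurent_ring M)"

definition contraction_alg ::
  "('c, 'm) ring_scheme \<Rightarrow> ('c, 'a, 'n) module_scheme \<Rightarrow> ('a \<Rightarrow> 'a)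
    \<Rightarrow> (nat \<Rightarrow> 'c, int \<Rightarrow> 'a) module" where
  "contraction_alg k M \<theta> = (laurent_alg k M)\<lparr>carrier :=
     generated_subalg (UP k) (laurent_alg k M)
       ((\<lambda>a. laurent_monom M a 0) ` fixed_set M \<theta> \<union>
        (\<lambda>a. laurent_monom M a (-1)) ` anti_fixed_set M \<theta>)\<rparr>"

definition contraction_ideal ::
  "('c, 'm) ring_scheme \<Rightarrow> ('c, 'a, 'n) module_scheme \<Rightarrow> ('a \<Rightarrow> 'a) \<Rightarrow> 'c \<Rightarrow> (int \<Rightarrow> 'a) set" where
  "contraction_ideal k M \<theta> t\<^sub>0 =
     PIdl\<^bsub>contraction_alg k M \<theta>\<^esub>
       (base_map (contraction_alg k M \<theta>) (monom (UP k) \<one>\<^bsub>k\<^esub> 1)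
        \<ominus>\<^bsub>contraction_alg k M \<theta>\<^esub> base_map (contraction_alg k M \<theta>) (monom (UP k) t\<^sub>0 0))"

definition contraction_at ::
  "('c, 'm) ring_scheme \<Rightarrow> ('c, 'a, 'n) module_scheme \<Rightarrow> ('a \<Rightarrow> 'a) \<Rightarrow> 'c
    \<Rightarrow> ('c, (int \<Rightarrow> 'a) set) module" where
  "contraction_at k M \<theta> t\<^sub>0 =
     alg_via
       (\<lambda>c. contraction_ideal k M \<theta> t\<^sub>0
          +>\<^bsub>contraction_alg k M \<theta>\<^esub> base_map (contraction_alg k M \<theta>) (monom (UP k) c 0))
       (contraction_alg k M \<theta> Quot contraction_ideal k M \<theta> t\<^sub>0)"

section \<open>The extension \<open>M[x]/(x\<^sup>2 - t\<^sub>0)\<close>\<close>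

definition quad_ideal :: "('c, 'a, 'n) module_scheme \<Rightarrow> 'c \<Rightarrow> (nat \<Rightarrow> 'a) set" where
  "quad_ideal M t\<^sub>0 =
     PIdl\<^bsub>UP M\<^esub> (monom (UP M) \<one>\<^bsub>M\<^esub> 2 \<ominus>\<^bsub>UP M\<^esub> monom (UP M) (base_map M t\<^sub>0) 0)"

definition quad_ext :: "('c, 'a, 'n) module_scheme \<Rightarrow> 'c \<Rightarrow> ('c, (nat \<Rightarrow> 'a) set) module" where
  "quad_ext M t\<^sub>0 =
     alg_via (\<lambda>c. quad_ideal M t\<^sub>0 +>\<^bsub>UP M\<^esub> monom (UP M) (base_map M c) 0)
       (UP M Quot quad_ideal M t\<^sub>0)"

text \<open>The class of \<open>a + b x\<close>.\<close>

definition quad_elt :: "('c, 'a, 'n) module_scheme \<Rightarrow> 'c \<Rightarrow> 'a \<Rightarrow> 'a \<Rightarrow> (nat \<Rightarrow> 'a) set" where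
  "quad_elt M t\<^sub>0 a b =
     quad_ideal M t\<^sub>0 +>\<^bsub>UP M\<^esub> (monom (UP M) a 0 \<oplus>\<^bsub>UP M\<^esub> monom (UP M) b 1)"

text \<open>
  The map \<open>a + b x \<mapsto> \<theta> a - \<theta> b x\<close>; the set below is a singleton because every class
  has exactly one representative of the form \<open>a + b x\<close>.
\<close>

definition quad_inv ::
  "('c, 'a, 'n) module_scheme \<Rightarrow> 'c \<Rightarrow> ('a \<Rightarrow> 'a) \<Rightarrow> (nat \<Rightarrow> 'a) set \<Rightarrow> (nat \<Rightarrow> 'a) set" where
  "quad_inv M t\<^sub>0 \<theta> X = the_elem
     {quad_elt M t\<^sub>0 (\<theta> a) (\<ominus>\<^bsub>M\<^esub> \<theta> b) | a b.
        a \<in> carrier M \<and> b \<in> carrier M \<and> X = quad_elt M t\<^sub>0 a b}"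

text \<open>
  The canonical homomorphism \<open>k[x]/(x\<^sup>2 - t\<^sub>0) \<rightarrow> M[x]/(x\<^sup>2 - t\<^sub>0)\<close>, induced by
  applying \<open>k \<rightarrow> M\<close> to the coefficients of polynomials.
\<close>

definition quad_map ::
  "('c, 'a, 'n) module_scheme \<Rightarrow> 'c \<Rightarrow> (nat \<Rightarrow> 'c) set \<Rightarrow> (nat \<Rightarrow> 'a) set" where
  "quad_map M t\<^sub>0 X = the_elem
     ((\<lambda>p. quad_ideal M t\<^sub>0 +>\<^bsub>UP M\<^esub> (\<lambda>n. base_map M (p n))) ` X)"

text \<open>\<open>M[x]/(x\<^sup>2 - t\<^sub>0)\<close> as an algebra over \<open>k[x]/(x\<^sup>2 - t\<^sub>0)\<close>.\<close>

definition quad_ext_alg ::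
  "('c, 'a, 'n) module_scheme \<Rightarrow> 'c \<Rightarrow> ((nat \<Rightarrow> 'c) set, (nat \<Rightarrow> 'a) set) module" where
  "quad_ext_alg M t\<^sub>0 = alg_via (quad_map M t\<^sub>0) (quad_ext M t\<^sub>0)"

text \<open>
  \<open>\<Psi>\<close> is the scalar extension to \<open>k[x]/(x\<^sup>2 - t\<^sub>0)\<close> of a \<open>k\<close>-linear map \<open>\<psi>\<close> from
  \<open>M\<close> to \<open>N[x]/(x\<^sup>2 - t\<^sub>0)\<close>, that is, \<open>\<alpha> \<otimes> m \<mapsto> \<alpha> \<psi>(m)\<close> under the identification of
  the tensor product with \<open>M[x]/(x\<^sup>2 - t\<^sub>0)\<close>.
\<close>

definition is_quad_scalar_ext ::
  "('c, 'a, 'n) module_scheme \<Rightarrow> ('c, 'b, 'o) module_scheme \<Rightarrow> 'c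
    \<Rightarrow> ('a \<Rightarrow> (nat \<Rightarrow> 'b) set) \<Rightarrow> ((nat \<Rightarrow> 'a) set \<Rightarrow> (nat \<Rightarrow> 'b) set) \<Rightarrow> bool" where
  "is_quad_scalar_ext M N t\<^sub>0 \<psi> \<Psi> \<longleftrightarrow>
     (\<forall>a\<in>carrier M. \<forall>b\<in>carrier M.
        \<Psi> (quad_elt M t\<^sub>0 a b) =
        \<psi> a \<oplus>\<^bsub>quad_ext N t\<^sub>0\<^esub> (quad_elt N t\<^sub>0 \<zero>\<^bsub>N\<^esub> \<one>\<^bsub>N\<^esub> \<otimes>\<^bsub>quad_ext N t\<^sub>0\<^esub> \<psi> b))"

end

(*
  Inverting t\<^sub>0 makes x a unit, so sending the square root of t to x defines a homomorphism
  \<Phi> from A[\<surd>t, 1/\<surd>t] to A[x]/(x^2 - t\<^sub>0). It maps the contraction algebra into the fixed ring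
  of the involution, which is {a + b x | \<theta> a = a, \<theta> b = -b}, and has the set-theoretic section
  \<rho>(a + b x) = a + t\<^sub>0 b / \<surd>t there. Modulo t - t\<^sub>0 the section becomes a ring homomorphism, because
  t\<^sub>0 b d / t and b d agree for anti-fixed b and d; the maps f and \<rho>(\<Phi> f) then agree modulo
  t - t\<^sub>0 on generators, hence everywhere. So \<Phi> induces an isomorphism of the quotient onto the
  fixed ring. Since 2 is invertible, every element of A is uniquely a sum of a fixed and an
  anti-fixed element, so for any unit s the map (a, b) \<mapsto> a + s b is bijective on such
  pairs. With s = t\<^sub>0 and s = 1 this gives the statement on scalar extensions, and with
  s = \<surd>t\<^sub>0 it gives (3).
*)
theory Submission
  imports Defs
begin

section \<open>Laurent polynomials\<close>

text \<open>Computing with cosets of polynomials is avoided: pairs \<open>(a, b)\<close> carry an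
  explicit product, evaluation at x compares them once with the quotient, and statements about
  \<open>quad_ext\<close> are transported from there. The contraction algebra is accessible only as
  the least subalgebra containing its generators, so a claim about all its elements takes the form
  that some subring contains the generators and the variable. The kernel of \<Phi> is also found
  this way, without a normal form: once f is congruent to \<rho>(\<Phi> f) for every f, \<Phi> f = 0
  forces f into the ideal. The two units of the scalar extension come from (a + b x) + x (c + d x) =
  (a + \<open>t\<^sub>0\<close> d) + (c + b) x, whose coordinates involve the disjoint pairs (a, d)
  and (c, b), each a fixed element plus a unit times an anti-fixed one.\<close>

context cring
begin

abbreviation "lr \<equiv> laurent_ring R"

lemma laurent_simps:
  "carrier lr = {f. (\<forall>n. f n \<in> carrier R) \<and> finite {n. f n \<noteq> \<zero>}}"
  "(f \<oplus>\<^bsub>lr\<^esub> g) = (\<lambda>n. f n \<oplus> g n)"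
  "\<zero>\<^bsub>lr\<^esub> = (\<lambda>n. \<zero>)"
  "\<one>\<^bsub>lr\<^esub> = laurent_monom R \<one> 0"
  by (auto simp: laurent_ring_def laurent_monom_def)

lemma laurent_coeff_closed: "f \<in> carrier lr \<Longrightarrow> f n \<in> carrier R"
  by (simp add: laurent_simps)

lemma laurent_support: "f \<in> carrier lr \<Longrightarrow> finite {n. f n \<noteq> \<zero>}"
  by (simp add: laurent_simps)

lemma laurent_monom_closed [simp]: "a \<in> carrier R \<Longrightarrow> laurent_monom R a n \<in> carrier lr"
  by (auto simp: laurent_simps laurent_monom_def intro: finite_subset[of _ "{n}"])

lemma laurent_add_closed [simp]:
  assumes "f \<in> carrier lr" "g \<in> carrier lr"
  shows "f \<oplus>\<^bsub>lr\<^esub> g \<in> carrier lr"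
proof -
  have "finite ({n. f n \<noteq> \<zero>} \<union> {n. g n \<noteq> \<zero>})"
    using assms laurent_support by simp
  then have "finite {n. f n \<oplus> g n \<noteq> \<zero>}"
    by (rule rev_finite_subset) auto
  then show ?thesis
    using assms[THEN laurent_coeff_closed] by (simp add: laurent_simps)
qed

lemma laurent_zero_closed [simp]: "\<zero>\<^bsub>lr\<^esub> \<in> carrier lr"
  by (simp add: laurent_simps)

lemma laurent_one_closed [simp]: "\<one>\<^bsub>lr\<^esub> \<in> carrier lr"
  by (simp add: laurent_simps(4))

lemma laurent_uminus_closed:
  assumes "f \<in> carrier lr"
  shows "(\<lambda>n. \<ominus> f n) \<in> carrier lr"
proof -
  have "{n. \<ominus> f n \<noteq> \<zero>} \<subseteq> {n. f n \<noteq> \<zero>}" by auto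
  with assms show ?thesis by (auto simp: laurent_simps intro: finite_subset)
qed

lemma laurent_abelian_group: "abelian_group lr"
proof (rule abelian_groupI)
  fix f g h assume "f \<in> carrier lr" "g \<in> carrier lr" "h \<in> carrier lr"
  then show "f \<oplus>\<^bsub>lr\<^esub> g \<oplus>\<^bsub>lr\<^esub> h = f \<oplus>\<^bsub>lr\<^esub> (g \<oplus>\<^bsub>lr\<^esub> h)"
    by (auto simp: laurent_simps a_assoc)
next
  fix f g assume "f \<in> carrier lr" "g \<in> carrier lr"
  then show "f \<oplus>\<^bsub>lr\<^esub> g = g \<oplus>\<^bsub>lr\<^esub> f"
    by (auto simp: laurent_simps a_comm)
next
  fix f assume "f \<in> carrier lr"
  then show "\<zero>\<^bsub>lr\<^esub> \<oplus>\<^bsub>lr\<^esub> f = f"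
    by (auto simp: laurent_simps)
next
  fix f assume "f \<in> carrier lr"
  then show "\<exists>g\<in>carrier lr. g \<oplus>\<^bsub>lr\<^esub> f = \<zero>\<^bsub>lr\<^esub>"
    by (intro bexI[OF _ laurent_uminus_closed[of f]]) (auto simp: laurent_simps l_neg)
qed auto

text \<open>Removing one exponent at a time exhausts the finite support. The principle replaces the
  rearrangement of double sums: closure, associativity and commutativity of the product are reduced
  to monomials by it.\<close>

lemma laurent_induct [consumes 1, case_names zero add]:
  assumes "f \<in> carrier lr"
    and "P \<zero>\<^bsub>lr\<^esub>"
    and "\<And>a n f. a \<in> carrier R \<Longrightarrow> f \<in> carrier lr \<Longrightarrow> P f \<Longrightarrow> P (laurent_monom R a n \<oplus>\<^bsub>lr\<^esub> f)"
  shows "P f"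
proof -
  have "P f" if "finite F" "f \<in> carrier lr" "{n. f n \<noteq> \<zero>} \<subseteq> F" for f F
    using that
  proof (induction F arbitrary: f rule: finite_induct)
    case empty
    then have "f = \<zero>\<^bsub>lr\<^esub>" by (auto simp: laurent_simps)
    with assms(2) show ?case by simp
  next
    case (insert n F)
    \<comment> \<open>\<open>F\<close> only bounds the support, so \<open>f n\<close> may already
      vanish; the monomial split off is then zero and no case distinction arises.\<close>
    define g where "g = f(n := \<zero>)"
    have g: "g \<in> carrier lr"
      using insert.prems(1) rev_finite_subset[OF laurent_support, of f "{i. g i \<noteq> \<zero>}"]
      by (auto simp: laurent_simps g_def subset_iff)
    have "f = laurent_monom R (f n) n \<oplus>\<^bsub>lr\<^esub> g"
      using insert.prems(1) by (auto simp: laurent_simps laurent_monom_def g_def)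
    moreover have "P g"
      using insert.prems by (intro insert.IH[OF g]) (auto simp: g_def)
    ultimately show ?case
      using assms(3)[of "f n" g n] g laurent_coeff_closed[OF insert.prems(1)] by simp
  qed
  then show ?thesis using laurent_support[OF assms(1)] assms(1) by blast
qed

text \<open>Products and evaluations sum over the support of an argument, which varies with the
  argument. Padding with zero terms moves such sums to a common finite index set, where they can be
  added.\<close>

lemma finsum_superset:
  assumes "finite F" "S \<subseteq> F" "\<And>i. i \<in> F - S \<Longrightarrow> u i = \<zero>" "\<And>i. i \<in> F \<Longrightarrow> u i \<in> carrier R"
  shows "finsum R u S = finsum R u F"
  using assms by (intro add.finprod_mono_neutral_cong_left) auto

lemma laurent_mult_eq:
  assumes "f \<in> carrier lr" "g \<in> carrier lr" "finite F" "{i. f i \<noteq> \<zero>} \<subseteq> F"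
  shows "(f \<otimes>\<^bsub>lr\<^esub> g) n = (\<Oplus>i\<in>F. f i \<otimes> g (n - i))"
proof -
  note [simp] = assms(1,2)[THEN laurent_coeff_closed]
  have "(f \<otimes>\<^bsub>lr\<^esub> g) n = (\<Oplus>i\<in>{i. f i \<noteq> \<zero>}. f i \<otimes> g (n - i))"
    by (simp add: laurent_ring_def)
  also have "\<dots> = (\<Oplus>i\<in>F. f i \<otimes> g (n - i))"
    using assms by (intro finsum_superset) auto
  finally show ?thesis .
qed

lemma laurent_monom_mult:
  assumes "a \<in> carrier R" "g \<in> carrier lr"
  shows "laurent_monom R a m \<otimes>\<^bsub>lr\<^esub> g = (\<lambda>n. a \<otimes> g (n - m))"
proof
  note [simp] = assms(2)[THEN laurent_coeff_closed]
  fix n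
  have "(laurent_monom R a m \<otimes>\<^bsub>lr\<^esub> g) n = (\<Oplus>i\<in>{m}. laurent_monom R a m i \<otimes> g (n - i))"
    using assms by (intro laurent_mult_eq laurent_monom_closed) (auto simp: laurent_monom_def)
  then show "(laurent_monom R a m \<otimes>\<^bsub>lr\<^esub> g) n = a \<otimes> g (n - m)"
    using assms by (simp add: laurent_monom_def)
qed

lemma laurent_monom_monom:
  assumes "a \<in> carrier R" "b \<in> carrier R"
  shows "laurent_monom R a m \<otimes>\<^bsub>lr\<^esub> laurent_monom R b n = laurent_monom R (a \<otimes> b) (m + n)"
  using assms by (auto simp: laurent_monom_mult) (auto simp: laurent_monom_def)

lemma laurent_mult_zero:
  "f \<in> carrier lr \<Longrightarrow> f \<otimes>\<^bsub>lr\<^esub> \<zero>\<^bsub>lr\<^esub> = \<zero>\<^bsub>lr\<^esub>"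
  "f \<in> carrier lr \<Longrightarrow> \<zero>\<^bsub>lr\<^esub> \<otimes>\<^bsub>lr\<^esub> f = \<zero>\<^bsub>lr\<^esub>"
  by (auto simp: laurent_ring_def intro!: ext add.finprod_one_eqI)

text \<open>The index set is the support of the left factor, the same in all three products, so the
  sums are compared term by term.\<close>

lemma laurent_r_distr:
  assumes "f \<in> carrier lr" "g \<in> carrier lr" "h \<in> carrier lr"
  shows "f \<otimes>\<^bsub>lr\<^esub> (g \<oplus>\<^bsub>lr\<^esub> h) = (f \<otimes>\<^bsub>lr\<^esub> g) \<oplus>\<^bsub>lr\<^esub> (f \<otimes>\<^bsub>lr\<^esub> h)"
proof
  note [simp] = assms[THEN laurent_coeff_closed]
  fix n
  note eq = laurent_mult_eq[OF assms(1) _ laurent_support[OF assms(1)] subset_refl]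
  have "(f \<otimes>\<^bsub>lr\<^esub> (g \<oplus>\<^bsub>lr\<^esub> h)) n =
      (\<Oplus>i\<in>{i. f i \<noteq> \<zero>}. f i \<otimes> g (n - i) \<oplus> f i \<otimes> h (n - i))"
    using assms by (simp add: eq) (simp add: laurent_simps(2) r_distr)
  also have "\<dots> = ((f \<otimes>\<^bsub>lr\<^esub> g) \<oplus>\<^bsub>lr\<^esub> (f \<otimes>\<^bsub>lr\<^esub> h)) n"
    using assms by (simp add: laurent_simps(2) eq finsum_addf)
  finally show "(f \<otimes>\<^bsub>lr\<^esub> (g \<oplus>\<^bsub>lr\<^esub> h)) n = ((f \<otimes>\<^bsub>lr\<^esub> g) \<oplus>\<^bsub>lr\<^esub> (f \<otimes>\<^bsub>lr\<^esub> h)) n" .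
qed

lemma laurent_l_distr:
  assumes "f \<in> carrier lr" "g \<in> carrier lr" "h \<in> carrier lr"
  shows "(f \<oplus>\<^bsub>lr\<^esub> g) \<otimes>\<^bsub>lr\<^esub> h = (f \<otimes>\<^bsub>lr\<^esub> h) \<oplus>\<^bsub>lr\<^esub> (g \<otimes>\<^bsub>lr\<^esub> h)"
proof
  note [simp] = assms[THEN laurent_coeff_closed]
  fix n
  \<comment> \<open>The left factors have different supports, and that of the sum may be smaller by
    cancellation; the union contains all three.\<close>
  define F where "F = {i. f i \<noteq> \<zero>} \<union> {i. g i \<noteq> \<zero>}"
  have F: "finite F" using assms laurent_support by (simp add: F_def)
  have eq: "(u \<otimes>\<^bsub>lr\<^esub> h) n = (\<Oplus>i\<in>F. u i \<otimes> h (n - i))"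
    if "u \<in> carrier lr" "{i. u i \<noteq> \<zero>} \<subseteq> F" for u
    using that F assms by (intro laurent_mult_eq) auto
  have "((f \<oplus>\<^bsub>lr\<^esub> g) \<otimes>\<^bsub>lr\<^esub> h) n = (\<Oplus>i\<in>F. (f \<oplus>\<^bsub>lr\<^esub> g) i \<otimes> h (n - i))"
    using assms by (intro eq laurent_add_closed) (auto simp: F_def laurent_simps(2))
  also have "\<dots> = (\<Oplus>i\<in>F. f i \<otimes> h (n - i) \<oplus> g i \<otimes> h (n - i))"
    using assms by (simp add: laurent_simps(2) l_distr)
  also have "\<dots> = (f \<otimes>\<^bsub>lr\<^esub> h) n \<oplus> (g \<otimes>\<^bsub>lr\<^esub> h) n"
    using assms eq[of f] eq[of g] by (simp add: F_def finsum_addf)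
  finally show "((f \<oplus>\<^bsub>lr\<^esub> g) \<otimes>\<^bsub>lr\<^esub> h) n = ((f \<otimes>\<^bsub>lr\<^esub> h) \<oplus>\<^bsub>lr\<^esub> (g \<otimes>\<^bsub>lr\<^esub> h)) n"
    by (simp add: laurent_simps(2))
qed

text \<open>Finiteness of the support of a product is obtained by splitting both factors into
  monomials, whose product is again a monomial.\<close>

lemma laurent_mult_closed [simp]:
  assumes "f \<in> carrier lr" "g \<in> carrier lr"
  shows "f \<otimes>\<^bsub>lr\<^esub> g \<in> carrier lr"
  using assms
proof (induction rule: laurent_induct)
  case zero
  then show ?case by (simp add: laurent_mult_zero)
next
  case (add a n f)
  have "laurent_monom R a n \<otimes>\<^bsub>lr\<^esub> g \<in> carrier lr"
    using add.prems
  proof (induction rule: laurent_induct)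
    case zero
    then show ?case using add by (simp add: laurent_mult_zero)
  next
    case (add b m g)
    then show ?case using \<open>a \<in> carrier R\<close> by (simp add: laurent_r_distr laurent_monom_monom)
  qed
  then show ?case using add by (simp add: laurent_l_distr)
qed

text \<open>Three nested inductions, one per factor, leave three monomials, where associativity in
  \<open>R\<close> and of the addition of exponents suffices. Both distributive laws serve here,
  commutativity being proved only afterwards.\<close>

lemma laurent_m_assoc:
  assumes "f \<in> carrier lr" "g \<in> carrier lr" "h \<in> carrier lr"
  shows "f \<otimes>\<^bsub>lr\<^esub> g \<otimes>\<^bsub>lr\<^esub> h = f \<otimes>\<^bsub>lr\<^esub> (g \<otimes>\<^bsub>lr\<^esub> h)"
  using assms
proof (induction rule: laurent_induct)
  case zero
  then show ?case by (simp add: laurent_mult_zero)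
next
  case f: (add a l f)
  have "laurent_monom R a l \<otimes>\<^bsub>lr\<^esub> g \<otimes>\<^bsub>lr\<^esub> h = laurent_monom R a l \<otimes>\<^bsub>lr\<^esub> (g \<otimes>\<^bsub>lr\<^esub> h)"
    using f.prems
  proof (induction rule: laurent_induct)
    case zero
    then show ?case using f by (simp add: laurent_mult_zero)
  next
    case g: (add b m g)
    have "laurent_monom R a l \<otimes>\<^bsub>lr\<^esub> laurent_monom R b m \<otimes>\<^bsub>lr\<^esub> h =
        laurent_monom R a l \<otimes>\<^bsub>lr\<^esub> (laurent_monom R b m \<otimes>\<^bsub>lr\<^esub> h)"
      using g.prems
    proof (induction rule: laurent_induct)
      case zero
      then show ?case using f g by (simp add: laurent_mult_zero)
    next
      case (add c n h)
      then show ?case using f g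
        by (simp add: laurent_r_distr laurent_monom_monom m_assoc add.assoc)
    qed
    then show ?case using f g by (simp add: laurent_l_distr laurent_r_distr)
  qed
  then show ?case using f by (simp add: laurent_l_distr)
qed

lemma laurent_m_comm:
  assumes "f \<in> carrier lr" "g \<in> carrier lr"
  shows "f \<otimes>\<^bsub>lr\<^esub> g = g \<otimes>\<^bsub>lr\<^esub> f"
  using assms
proof (induction rule: laurent_induct)
  case zero
  then show ?case by (simp add: laurent_mult_zero)
next
  case (add a n f)
  have "laurent_monom R a n \<otimes>\<^bsub>lr\<^esub> g = g \<otimes>\<^bsub>lr\<^esub> laurent_monom R a n"
    using add.prems
  proof (induction rule: laurent_induct)
    case zero
    then show ?case using add by (simp add: laurent_mult_zero)
  next
    case (add b m g)
    then show ?case using \<open>a \<in> carrier R\<close>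
      by (simp add: laurent_r_distr laurent_l_distr laurent_monom_monom m_comm add.commute)
  qed
  then show ?case using add by (simp add: laurent_l_distr laurent_r_distr)
qed

lemma laurent_l_one: "f \<in> carrier lr \<Longrightarrow> \<one>\<^bsub>lr\<^esub> \<otimes>\<^bsub>lr\<^esub> f = f"
  by (simp add: laurent_simps(4) laurent_monom_mult laurent_coeff_closed)

lemma laurent_cring: "cring lr"
  by (intro cringI comm_monoidI laurent_abelian_group)
    (simp_all add: laurent_m_assoc laurent_l_one laurent_l_distr, simp add: laurent_m_comm)

lemma laurent_monom_add:
  assumes "a \<in> carrier R" "b \<in> carrier R"
  shows "laurent_monom R (a \<oplus> b) n = laurent_monom R a n \<oplus>\<^bsub>lr\<^esub> laurent_monom R b n"
  using assms by (auto simp: laurent_simps(2) laurent_monom_def)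

lemma laurent_monom_zero: "laurent_monom R \<zero> n = \<zero>\<^bsub>lr\<^esub>"
  by (auto simp: laurent_simps(3) laurent_monom_def)

end

section \<open>Evaluation homomorphisms on Laurent polynomials\<close>

definition laurent_eval ::
  "('a, 'm) ring_scheme \<Rightarrow> ('b, 'n) ring_scheme \<Rightarrow> ('a \<Rightarrow> 'b) \<Rightarrow> (int \<Rightarrow> 'b) \<Rightarrow> (int \<Rightarrow> 'a) \<Rightarrow> 'b" where
  "laurent_eval R S h e f = (\<Oplus>\<^bsub>S\<^esub>n\<in>{n. f n \<noteq> \<zero>\<^bsub>R\<^esub>}. h (f n) \<otimes>\<^bsub>S\<^esub> e n)"

text \<open>The powers of the value of the variable enter as a family \<open>e\<close>; its two laws
  make \<open>e 1\<close> a unit with inverse \<open>e (-1)\<close>, as negative exponents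
  require.\<close>

locale laurent_eval_hom = ring_hom_cring R S h
  for R (structure) and S (structure) and h +
  fixes e :: "int \<Rightarrow> 'c"
  assumes e_closed [simp]: "e n \<in> carrier S"
    and e_zero: "e 0 = \<one>\<^bsub>S\<^esub>"
    and e_add: "e (m + n) = e m \<otimes>\<^bsub>S\<^esub> e n"
begin

abbreviation "ev \<equiv> laurent_eval R S h e"

lemma ev_eq:
  assumes "f \<in> carrier (laurent_ring R)" "finite F" "{n. f n \<noteq> \<zero>} \<subseteq> F"
  shows "ev f = (\<Oplus>\<^bsub>S\<^esub>n\<in>F. h (f n) \<otimes>\<^bsub>S\<^esub> e n)"
  unfolding laurent_eval_def
  using assms R.laurent_coeff_closed[OF assms(1)] by (intro S.finsum_superset) auto

lemma ev_monom [simp]: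
  assumes "a \<in> carrier R"
  shows "ev (laurent_monom R a n) = h a \<otimes>\<^bsub>S\<^esub> e n"
proof -
  have "ev (laurent_monom R a n) = (\<Oplus>\<^bsub>S\<^esub>i\<in>{n}. h (laurent_monom R a n i) \<otimes>\<^bsub>S\<^esub> e i)"
    using assms by (intro ev_eq R.laurent_monom_closed) (auto simp: laurent_monom_def)
  then show ?thesis using assms by (simp add: laurent_monom_def)
qed

lemma ev_closed: "f \<in> carrier (laurent_ring R) \<Longrightarrow> ev f \<in> carrier S"
  unfolding laurent_eval_def by (intro S.finsum_closed) (simp add: R.laurent_coeff_closed)

lemma ev_add:
  assumes "f \<in> carrier (laurent_ring R)" "g \<in> carrier (laurent_ring R)"
  shows "ev (f \<oplus>\<^bsub>laurent_ring R\<^esub> g) = ev f \<oplus>\<^bsub>S\<^esub> ev g"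
proof -
  note [simp] = assms[THEN R.laurent_coeff_closed]
  define F where "F = {i. f i \<noteq> \<zero>} \<union> {i. g i \<noteq> \<zero>}"
  have F: "finite F" using assms R.laurent_support by (simp add: F_def)
  have eq: "ev u = (\<Oplus>\<^bsub>S\<^esub>i\<in>F. h (u i) \<otimes>\<^bsub>S\<^esub> e i)"
    if "u \<in> carrier (laurent_ring R)" "{i. u i \<noteq> \<zero>} \<subseteq> F" for u
    using that F assms by (intro ev_eq) auto
  have "ev (f \<oplus>\<^bsub>laurent_ring R\<^esub> g) = (\<Oplus>\<^bsub>S\<^esub>i\<in>F. h ((f \<oplus>\<^bsub>laurent_ring R\<^esub> g) i) \<otimes>\<^bsub>S\<^esub> e i)"
    using assms by (intro eq R.laurent_add_closed) (auto simp: F_def R.laurent_simps(2))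
  also have "\<dots> = (\<Oplus>\<^bsub>S\<^esub>i\<in>F. h (f i) \<otimes>\<^bsub>S\<^esub> e i \<oplus>\<^bsub>S\<^esub> h (g i) \<otimes>\<^bsub>S\<^esub> e i)"
    using assms by (simp add: R.laurent_simps(2) S.l_distr)
  also have "\<dots> = ev f \<oplus>\<^bsub>S\<^esub> ev g"
    using assms eq[of f] eq[of g] by (simp add: F_def S.finsum_addf)
  finally show ?thesis .
qed

lemma ev_zero: "ev \<zero>\<^bsub>laurent_ring R\<^esub> = \<zero>\<^bsub>S\<^esub>"
  by (simp add: laurent_eval_def laurent_ring_def)

text \<open>Both sides are additive in \<open>f\<close> and in \<open>g\<close>; for two monomials
  the identity is \<open>e_add\<close> together with commutativity of \<open>S\<close>.\<close>

lemma ev_mult: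
  assumes "f \<in> carrier (laurent_ring R)" "g \<in> carrier (laurent_ring R)"
  shows "ev (f \<otimes>\<^bsub>laurent_ring R\<^esub> g) = ev f \<otimes>\<^bsub>S\<^esub> ev g"
  using assms
proof (induction rule: R.laurent_induct)
  case zero
  then show ?case by (simp add: R.laurent_mult_zero ev_zero ev_closed)
next
  case (add a n f)
  have "ev (laurent_monom R a n \<otimes>\<^bsub>laurent_ring R\<^esub> g) = ev (laurent_monom R a n) \<otimes>\<^bsub>S\<^esub> ev g"
    using add.prems
  proof (induction rule: R.laurent_induct)
    case zero
    then show ?case using add by (simp add: R.laurent_mult_zero ev_zero ev_closed)
  next
    case (add b m g)
    then show ?case using \<open>a \<in> carrier R\<close>
      by (simp add: R.laurent_r_distr R.laurent_monom_monom R.laurent_monom_closed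
          R.laurent_mult_closed ev_add ev_closed S.r_distr e_add S.m_ac)
  qed
  then show ?case using add
    by (simp add: R.laurent_l_distr R.laurent_monom_closed R.laurent_mult_closed ev_add ev_closed
        S.l_distr del: ev_monom)
qed

lemma ev_hom: "ev \<in> ring_hom (laurent_ring R) S"
  by (intro ring_hom_memI)
    (auto simp: ev_closed ev_mult ev_add R.laurent_simps(4) e_zero)

end

section \<open>Algebras over a commutative ring\<close>

lemma alg_via_simps [simp]:
  "carrier (alg_via h S) = carrier S" "mult (alg_via h S) = mult S" "one (alg_via h S) = one S"
  "zero (alg_via h S) = zero S" "add (alg_via h S) = add S" "smult (alg_via h S) c x = h c \<otimes>\<^bsub>S\<^esub> x"
  by (simp_all add: alg_via_def)

lemma alg_via_a_inv [simp]: "a_inv (alg_via h S) = a_inv S"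
  by (simp add: fun_eq_iff a_inv_def m_inv_def)

lemma alg_via_cring:
  assumes "cring S"
  shows "cring (alg_via h S)"
proof -
  interpret cring S by fact
  show ?thesis
  proof (intro cringI abelian_groupI comm_monoidI)
    show "\<exists>y\<in>carrier (alg_via h S). y \<oplus>\<^bsub>alg_via h S\<^esub> x = \<zero>\<^bsub>alg_via h S\<^esub>"
      if "x \<in> carrier (alg_via h S)" for x
      using that by (intro bexI[of _ "\<ominus>\<^bsub>S\<^esub> x"]) (auto simp: l_neg)
  qed (simp_all add: m_assoc a_assoc l_distr, simp_all add: m_comm a_comm)
qed

lemma alg_via_algebra:
  assumes "cring k" "cring S" "h \<in> ring_hom k S"
  shows "algebra k (alg_via h S)"
proof -
  interpret k: cring k by fact
  interpret S: cring S by fact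
  interpret h: ring_hom_cring k S h using assms by (intro ring_hom_cringI) auto
  show ?thesis
    by (intro algebraI assms alg_via_cring) (auto simp: S.l_distr S.r_distr S.m_assoc)
qed

lemma alg_via_ring_hom:
  "f \<in> ring_hom (alg_via h S) (alg_via h' S') \<longleftrightarrow> f \<in> ring_hom S S'"
  by (simp add: ring_hom_def)

text \<open>Homomorphisms that agree on generators agree on everything generated, since their
  equalizer is a subring. \<open>\<pi>_\<rho>_\<Phi>\<close> is obtained in this way.\<close>

lemma ring_hom_equalizer_subring:
  assumes "cring S" "cring T" "f \<in> ring_hom S T" "g \<in> ring_hom S T"
  shows "subring {x \<in> carrier S. f x = g x} S"
proof -
  interpret S: cring S by fact
  interpret f: ring_hom_cring S T f using assms by (intro ring_hom_cringI)
  interpret g: ring_hom_cring S T g using assms by (intro ring_hom_cringI)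
  show ?thesis by (rule S.subringI) auto
qed

lemma alg_homI:
  assumes "h \<in> ring_hom M N"
    and "\<And>c x. c \<in> carrier k \<Longrightarrow> x \<in> carrier M \<Longrightarrow> h (c \<odot>\<^bsub>M\<^esub> x) = c \<odot>\<^bsub>N\<^esub> h x"
  shows "h \<in> alg_hom k M N"
  using assms by (simp add: alg_hom_def)

lemma alg_hom_comp: "f \<in> alg_hom k M N \<Longrightarrow> g \<in> alg_hom k N P \<Longrightarrow> g \<circ> f \<in> alg_hom k M P"
  by (auto simp: alg_hom_def ring_hom_closed intro: ring_hom_trans)

lemma alg_iso_comp: "f \<in> alg_iso k M N \<Longrightarrow> g \<in> alg_iso k N P \<Longrightarrow> g \<circ> f \<in> alg_iso k M P"
  by (auto simp: alg_iso_def intro: alg_hom_comp bij_betw_trans)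

lemma alg_iso_inv:
  assumes "algebra k M" "f \<in> alg_iso k M N"
  shows "inv_into (carrier M) f \<in> alg_iso k N M"
proof -
  interpret algebra k M by fact
  have f: "f \<in> ring_hom M N" "bij_betw f (carrier M) (carrier N)"
    "\<And>c x. c \<in> carrier k \<Longrightarrow> x \<in> carrier M \<Longrightarrow> f (c \<odot>\<^bsub>M\<^esub> x) = c \<odot>\<^bsub>N\<^esub> f x"
    using assms(2) by (auto simp: alg_iso_def alg_hom_def)
  have "f \<in> ring_iso M N" using f by (simp add: ring_iso_def)
  then have "inv_into (carrier M) f \<in> ring_iso N M"
    by (rule ring_iso_set_sym[OF cring.axioms(1)[OF M_cring]])
  moreover have "inv_into (carrier M) f (c \<odot>\<^bsub>N\<^esub> y) = c \<odot>\<^bsub>M\<^esub> inv_into (carrier M) f y"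
    if "c \<in> carrier k" "y \<in> carrier N" for c y
  proof -
    have y: "inv_into (carrier M) f y \<in> carrier M" "f (inv_into (carrier M) f y) = y"
      using f(2) that by (auto simp: bij_betw_def inv_into_into f_inv_into_f)
    then have "c \<odot>\<^bsub>N\<^esub> y = f (c \<odot>\<^bsub>M\<^esub> inv_into (carrier M) f y)" using f(3) that by simp
    then show ?thesis using f(2) y that by (simp add: bij_betw_def)
  qed
  ultimately show ?thesis by (simp add: alg_iso_def alg_hom_def ring_iso_def)
qed

text \<open>Homomorphisms are total functions on a type, but only their values on the carrier count.
  This allows a map known only there, such as \<open>quad_inv\<close>, to be recognised as a
  composite of isomorphisms.\<close>

lemma alg_iso_cong:
  assumes "algebra k M" "f \<in> alg_iso k M N" "\<And>x. x \<in> carrier M \<Longrightarrow> g x = f x"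
  shows "g \<in> alg_iso k M N"
proof -
  interpret algebra k M by fact
  have "f \<in> ring_iso M N" using assms(2) by (simp add: alg_iso_def alg_hom_def ring_iso_def)
  then have "g \<in> ring_iso M N" using assms(3) by (intro ring_iso_restrict[of f N g]) simp_all
  then show ?thesis using assms(2,3) by (simp add: alg_iso_def alg_hom_def ring_iso_def)
qed

context algebra
begin

lemma base_map_closed [simp]: "c \<in> carrier R \<Longrightarrow> base_map M c \<in> carrier M"
  by (simp add: base_map_def)

lemma smult_eq_base_map: "c \<in> carrier R \<Longrightarrow> x \<in> carrier M \<Longrightarrow> c \<odot>\<^bsub>M\<^esub> x = base_map M c \<otimes>\<^bsub>M\<^esub> x"
  by (simp add: base_map_def smult_assoc2)

lemma base_map_hom: "base_map M \<in> ring_hom R M"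
  by (intro ring_hom_memI)
    (auto simp: smult_eq_base_map[symmetric], auto simp: base_map_def smult_l_distr smult_assoc1)

lemma base_map_ring_hom_cring: "ring_hom_cring R M (base_map M)"
  using base_map_hom R_cring M_cring by (intro ring_hom_cringI)

end

lemma alg_hom_base_map:
  assumes "algebra k M" "f \<in> alg_hom k M N" "c \<in> carrier k"
  shows "f (base_map M c) = base_map N c"
proof -
  interpret algebra k M by fact
  show ?thesis using assms by (auto simp: base_map_def alg_hom_def ring_hom_one)
qed

text \<open>Scalars act by multiplication with their images under \<open>base_map\<close>, so
  linearity of a ring homomorphism is a condition on constants only.\<close>

lemma alg_hom_of_base_map:
  assumes "algebra k M" "algebra k N" "f \<in> ring_hom M N"
    and "\<And>c. c \<in> carrier k \<Longrightarrow> f (base_map M c) = base_map N c"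
  shows "f \<in> alg_hom k M N"
proof -
  interpret M: algebra k M by fact
  interpret N: algebra k N by fact
  show ?thesis using assms(3,4)
    by (intro alg_homI) (auto simp: M.smult_eq_base_map N.smult_eq_base_map ring_hom_mult ring_hom_closed)
qed

section \<open>Pairs as a model of the quadratic extension\<close>

text \<open>The pair \<open>(a, b)\<close> stands for \<open>a + b x\<close> with \<open>x\<^sup>2 = t\<close>.\<close>

definition quad_pair :: "('c, 'a, 'n) module_scheme \<Rightarrow> 'c \<Rightarrow> ('c, 'a \<times> 'a) module" where
  "quad_pair M t =
     \<lparr>carrier = carrier M \<times> carrier M,
      mult = (\<lambda>(a, b) (c, d). (a \<otimes>\<^bsub>M\<^esub> c \<oplus>\<^bsub>M\<^esub> base_map M t \<otimes>\<^bsub>M\<^esub> (b \<otimes>\<^bsub>M\<^esub> d), a \<otimes>\<^bsub>M\<^esub> d \<oplus>\<^bsub>M\<^esub> b \<otimes>\<^bsub>M\<^esub> c)),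
      one = (\<one>\<^bsub>M\<^esub>, \<zero>\<^bsub>M\<^esub>),
      zero = (\<zero>\<^bsub>M\<^esub>, \<zero>\<^bsub>M\<^esub>),
      add = (\<lambda>(a, b) (c, d). (a \<oplus>\<^bsub>M\<^esub> c, b \<oplus>\<^bsub>M\<^esub> d)),
      smult = (\<lambda>c (a, b). (c \<odot>\<^bsub>M\<^esub> a, c \<odot>\<^bsub>M\<^esub> b))\<rparr>"

lemma quad_pair_simps [simp]:
  "carrier (quad_pair M t) = carrier M \<times> carrier M"
  "(a, b) \<otimes>\<^bsub>quad_pair M t\<^esub> (c, d) =
     (a \<otimes>\<^bsub>M\<^esub> c \<oplus>\<^bsub>M\<^esub> base_map M t \<otimes>\<^bsub>M\<^esub> (b \<otimes>\<^bsub>M\<^esub> d), a \<otimes>\<^bsub>M\<^esub> d \<oplus>\<^bsub>M\<^esub> b \<otimes>\<^bsub>M\<^esub> c)"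
  "\<one>\<^bsub>quad_pair M t\<^esub> = (\<one>\<^bsub>M\<^esub>, \<zero>\<^bsub>M\<^esub>)"
  "\<zero>\<^bsub>quad_pair M t\<^esub> = (\<zero>\<^bsub>M\<^esub>, \<zero>\<^bsub>M\<^esub>)"
  "(a, b) \<oplus>\<^bsub>quad_pair M t\<^esub> (c, d) = (a \<oplus>\<^bsub>M\<^esub> c, b \<oplus>\<^bsub>M\<^esub> d)"
  "r \<odot>\<^bsub>quad_pair M t\<^esub> (a, b) = (r \<odot>\<^bsub>M\<^esub> a, r \<odot>\<^bsub>M\<^esub> b)"
  by (simp_all add: quad_pair_def)

text \<open>From here on \<open>t\<close> is the scalar \<open>t\<^sub>0\<close>. The variable of
  the contraction algebra, (\<surd>t)^2, appears later as the Laurent monomial of exponent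
  2.\<close>

locale quad_algebra = algebra R M for R (structure) and M (structure) +
  fixes t
  assumes t_closed [simp]: "t \<in> carrier R"
begin

abbreviation "Q \<equiv> quad_pair M t"

lemma quad_pair_cring: "cring Q"
proof (intro cringI abelian_groupI comm_monoidI)
  show "\<exists>y\<in>carrier Q. y \<oplus>\<^bsub>Q\<^esub> x = \<zero>\<^bsub>Q\<^esub>" if "x \<in> carrier Q" for x
    using that by (intro bexI[of _ "(\<ominus>\<^bsub>M\<^esub> fst x, \<ominus>\<^bsub>M\<^esub> snd x)"]) (auto simp: M.l_neg)
qed (auto simp: r_distr l_distr m_ac M.a_ac)

lemma quad_pair_algebra: "algebra R Q"
  by (intro algebraI R_cring quad_pair_cring)
    (auto simp: smult_eq_base_map ring_hom_add[OF base_map_hom] ring_hom_mult[OF base_map_hom]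
      ring_hom_one[OF base_map_hom] r_distr l_distr m_ac)

lemma quad_pair_base_map: "c \<in> carrier R \<Longrightarrow> base_map Q c = (base_map M c, \<zero>\<^bsub>M\<^esub>)"
  by (simp add: base_map_def)

lemma quad_pair_const_hom: "ring_hom_cring M Q (\<lambda>a. (a, \<zero>\<^bsub>M\<^esub>))"
  by (intro ring_hom_cringI M_cring quad_pair_cring ring_hom_memI) auto

lemma UP_M_cring: "UP_cring M"
  by (simp add: UP_cring_def M_cring)

text \<open>Evaluation of polynomials at x. Its kernel turns out to be the ideal of x^2 - t, which
  identifies \<open>quad_ext\<close> with pairs.\<close>

definition "pair_eval = eval M Q (\<lambda>a. (a, \<zero>\<^bsub>M\<^esub>)) (\<zero>\<^bsub>M\<^esub>, \<one>\<^bsub>M\<^esub>)"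

lemma UP_univ: "UP_univ_prop M Q (\<lambda>a. (a, \<zero>\<^bsub>M\<^esub>)) (\<zero>\<^bsub>M\<^esub>, \<one>\<^bsub>M\<^esub>)"
  using quad_pair_const_hom
  by (simp add: UP_univ_prop_def UP_pre_univ_prop_def UP_M_cring UP_univ_prop_axioms_def)

lemma pair_eval_hom: "ring_hom_cring (UP M) Q pair_eval"
proof -
  interpret UP_univ_prop M Q "\<lambda>a. (a, \<zero>\<^bsub>M\<^esub>)" "UP M" "(\<zero>\<^bsub>M\<^esub>, \<one>\<^bsub>M\<^esub>)" pair_eval
    by (simp_all add: UP_univ pair_eval_def)
  show ?thesis by unfold_locales
qed

lemma pair_eval_monom_pow:
  assumes "a \<in> carrier M"
  shows "pair_eval (monom (UP M) a n) = (a, \<zero>\<^bsub>M\<^esub>) \<otimes>\<^bsub>Q\<^esub> (\<zero>\<^bsub>M\<^esub>, \<one>\<^bsub>M\<^esub>) [^]\<^bsub>Q\<^esub> n"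
proof -
  interpret E: UP_univ_prop M Q "\<lambda>a. (a, \<zero>\<^bsub>M\<^esub>)" "UP M" "(\<zero>\<^bsub>M\<^esub>, \<one>\<^bsub>M\<^esub>)" pair_eval
    by (simp_all add: UP_univ pair_eval_def)
  show ?thesis using assms by (rule E.Eval_monom)
qed

lemma pair_eval_monom:
  assumes "a \<in> carrier M"
  shows "pair_eval (monom (UP M) a 0) = (a, \<zero>\<^bsub>M\<^esub>)" "pair_eval (monom (UP M) a 1) = (\<zero>\<^bsub>M\<^esub>, a)"
    "pair_eval (monom (UP M) a 2) = (base_map M t \<otimes>\<^bsub>M\<^esub> a, \<zero>\<^bsub>M\<^esub>)"
  using assms m_comm[of a "base_map M t"]
  by (simp_all add: pair_eval_monom_pow numeral_2_eq_2 nat_pow_def)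

end

text \<open>A polynomial is the finite sum of its monomials; the predicate is carried along sums
  over arbitrary finite index sets.\<close>

lemma (in UP_ring) UP_induct [consumes 1, case_names zero add]:
  assumes "p \<in> carrier P"
    and "Q \<zero>\<^bsub>P\<^esub>"
    and "\<And>a n p. a \<in> carrier R \<Longrightarrow> p \<in> carrier P \<Longrightarrow> Q p \<Longrightarrow> Q (monom P a n \<oplus>\<^bsub>P\<^esub> p)"
  shows "Q p"
proof -
  have "Q (\<Oplus>\<^bsub>P\<^esub>i\<in>F. monom P (coeff P p i) i)" if "finite F" for F
    using that
  proof induction
    case empty
    then show ?case using assms(2) by simp
  next
    case (insert i F)
    then show ?case using assms(1) assms(3)[of "coeff P p i" _ i] by (simp add: Pi_def)
  qed
  from this[of "{..deg R p}"] show ?thesis by (simp add: up_repr assms(1))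
qed

section \<open>Division with remainder by x^2 - t\<close>

context quad_algebra
begin

definition "quad_poly = monom (UP M) \<one>\<^bsub>M\<^esub> 2 \<ominus>\<^bsub>UP M\<^esub> monom (UP M) (base_map M t) 0"

lemma quad_ideal_eq: "quad_ideal M t = {q \<otimes>\<^bsub>UP M\<^esub> quad_poly | q. q \<in> carrier (UP M)}"
  by (simp add: quad_ideal_def quad_poly_def cgenideal_def)

lemma quad_poly_closed [simp]: "quad_poly \<in> carrier (UP M)"
proof -
  interpret P: UP_cring M "UP M" by (simp_all add: UP_M_cring)
  show ?thesis by (simp add: quad_poly_def)
qed

text \<open>The identity a x^(m+2) = a x^m (x^2 - t) + a t x^m lowers the exponent by two at the
  cost of changing the coefficient; hence the induction over all \<open>a\<close> at once.\<close>

lemma monom_mod_quad_poly: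
  assumes a: "a \<in> carrier M"
  shows "\<exists>b\<in>carrier M. \<exists>c\<in>carrier M. \<exists>q\<in>carrier (UP M).
    monom (UP M) a n = q \<otimes>\<^bsub>UP M\<^esub> quad_poly \<oplus>\<^bsub>UP M\<^esub> (monom (UP M) b 0 \<oplus>\<^bsub>UP M\<^esub> monom (UP M) c 1)"
  using a
proof (induction n arbitrary: a rule: less_induct)
  case (less n)
  interpret P: UP_cring M "UP M" by (simp_all add: UP_M_cring)
  consider "n = 0" | "n = 1" | m where "n = m + 2"
    by (metis One_nat_def add_2_eq_Suc' not0_implies_Suc)
  then show ?case
  proof cases
    case 1
    then show ?thesis using less.prems
      by (intro bexI[of _ a] bexI[of _ "\<zero>\<^bsub>M\<^esub>"] bexI[of _ "\<zero>\<^bsub>UP M\<^esub>"]) auto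
  next
    case 2
    then show ?thesis using less.prems
      by (intro bexI[of _ a] bexI[of _ "\<zero>\<^bsub>M\<^esub>"] bexI[of _ "\<zero>\<^bsub>UP M\<^esub>"]) auto
  next
    case 3
    let ?a = "a \<otimes>\<^bsub>M\<^esub> base_map M t"
    obtain b c q where bcq: "b \<in> carrier M" "c \<in> carrier M" "q \<in> carrier (UP M)"
      "monom (UP M) ?a m = q \<otimes>\<^bsub>UP M\<^esub> quad_poly \<oplus>\<^bsub>UP M\<^esub> (monom (UP M) b 0 \<oplus>\<^bsub>UP M\<^esub> monom (UP M) c 1)"
      using less.IH[of m ?a] less.prems 3 by auto
    let ?m = "monom (UP M) a m"
    have "?m \<otimes>\<^bsub>UP M\<^esub> quad_poly = monom (UP M) a n \<ominus>\<^bsub>UP M\<^esub> monom (UP M) ?a m"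
      using less.prems 3 by (simp add: quad_poly_def a_minus_def P.P.r_distr P.P.r_minus flip: P.monom_mult)
    then have "monom (UP M) a n = ?m \<otimes>\<^bsub>UP M\<^esub> quad_poly \<oplus>\<^bsub>UP M\<^esub> monom (UP M) ?a m"
      using less.prems by (simp add: a_minus_def P.P.a_assoc P.P.l_neg)
    also have "\<dots> = (?m \<oplus>\<^bsub>UP M\<^esub> q) \<otimes>\<^bsub>UP M\<^esub> quad_poly \<oplus>\<^bsub>UP M\<^esub>
        (monom (UP M) b 0 \<oplus>\<^bsub>UP M\<^esub> monom (UP M) c 1)"
      using bcq less.prems by (simp add: P.P.l_distr P.P.a_assoc)
    finally show ?thesis using bcq less.prems by (intro bexI[of _ b] bexI[of _ c] bexI[of _ "?m \<oplus>\<^bsub>UP M\<^esub> q"]) auto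
  qed
qed

lemma mod_quad_poly:
  assumes "p \<in> carrier (UP M)"
  shows "\<exists>b\<in>carrier M. \<exists>c\<in>carrier M. \<exists>q\<in>carrier (UP M).
    p = q \<otimes>\<^bsub>UP M\<^esub> quad_poly \<oplus>\<^bsub>UP M\<^esub> (monom (UP M) b 0 \<oplus>\<^bsub>UP M\<^esub> monom (UP M) c 1)"
proof -
  interpret P: UP_cring M "UP M" by (simp_all add: UP_M_cring)
  from assms show ?thesis
  proof (induction rule: P.UP_induct)
    case zero
    then show ?case by (intro bexI[of _ "\<zero>\<^bsub>M\<^esub>"] bexI[of _ "\<zero>\<^bsub>UP M\<^esub>"]) auto
  next
    case (add a n p)
    obtain b c q where 1: "b \<in> carrier M" "c \<in> carrier M" "q \<in> carrier (UP M)"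
      "p = q \<otimes>\<^bsub>UP M\<^esub> quad_poly \<oplus>\<^bsub>UP M\<^esub> (monom (UP M) b 0 \<oplus>\<^bsub>UP M\<^esub> monom (UP M) c 1)"
      using add by auto
    obtain b' c' q' where 2: "b' \<in> carrier M" "c' \<in> carrier M" "q' \<in> carrier (UP M)"
      "monom (UP M) a n = q' \<otimes>\<^bsub>UP M\<^esub> quad_poly \<oplus>\<^bsub>UP M\<^esub> (monom (UP M) b' 0 \<oplus>\<^bsub>UP M\<^esub> monom (UP M) c' 1)"
      using monom_mod_quad_poly add by meson
    have "monom (UP M) a n \<oplus>\<^bsub>UP M\<^esub> p = (q' \<oplus>\<^bsub>UP M\<^esub> q) \<otimes>\<^bsub>UP M\<^esub> quad_poly \<oplus>\<^bsub>UP M\<^esub>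
        (monom (UP M) (b' \<oplus>\<^bsub>M\<^esub> b) 0 \<oplus>\<^bsub>UP M\<^esub> monom (UP M) (c' \<oplus>\<^bsub>M\<^esub> c) 1)"
      unfolding 1(4) 2(4) using 1(1-3) 2(1-3) by (simp add: P.P.l_distr P.P.a_ac)
    then show ?case using 1(1-3) 2(1-3)
      by (intro bexI[of _ "b' \<oplus>\<^bsub>M\<^esub> b"] bexI[of _ "c' \<oplus>\<^bsub>M\<^esub> c"] bexI[of _ "q' \<oplus>\<^bsub>UP M\<^esub> q"]) auto
  qed
qed

lemma pair_eval_linear:
  "a \<in> carrier M \<Longrightarrow> b \<in> carrier M \<Longrightarrow>
    pair_eval (monom (UP M) a 0 \<oplus>\<^bsub>UP M\<^esub> monom (UP M) b 1) = (a, b)"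
proof -
  interpret P: UP_cring M "UP M" by (simp_all add: UP_M_cring)
  interpret ring_hom_cring "UP M" Q pair_eval by (rule pair_eval_hom)
  show "a \<in> carrier M \<Longrightarrow> b \<in> carrier M \<Longrightarrow> ?thesis"
    using pair_eval_monom by simp
qed

lemma pair_eval_quad_poly: "pair_eval quad_poly = \<zero>\<^bsub>Q\<^esub>"
proof -
  interpret P: UP_cring M "UP M" by (simp_all add: UP_M_cring)
  interpret Q: cring Q by (rule quad_pair_cring)
  interpret ring_hom_cring "UP M" Q pair_eval by (rule pair_eval_hom)
  have "pair_eval quad_poly = (base_map M t, \<zero>\<^bsub>M\<^esub>) \<ominus>\<^bsub>Q\<^esub> (base_map M t, \<zero>\<^bsub>M\<^esub>)"
    using pair_eval_monom[of "\<one>\<^bsub>M\<^esub>"] pair_eval_monom[of "base_map M t"]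
    by (simp add: quad_poly_def a_minus_def del: quad_pair_simps(2-))
  then show ?thesis by (simp add: a_minus_def Q.r_neg del: quad_pair_simps(2-))
qed

text \<open>By division a polynomial is a multiple of \<open>quad_poly\<close> plus some b + c x,
  and it evaluates to (b, c); so exactly the multiples evaluate to zero.\<close>

lemma kernel_pair_eval: "a_kernel (UP M) Q pair_eval = quad_ideal M t"
proof -
  interpret P: UP_cring M "UP M" by (simp_all add: UP_M_cring)
  interpret Q: cring Q by (rule quad_pair_cring)
  interpret ring_hom_cring "UP M" Q pair_eval by (rule pair_eval_hom)
  have "p \<in> quad_ideal M t" if p: "p \<in> carrier (UP M)" and p0: "pair_eval p = \<zero>\<^bsub>Q\<^esub>" for p
  proof -
    obtain b c q where 1: "b \<in> carrier M" "c \<in> carrier M" "q \<in> carrier (UP M)"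
      "p = q \<otimes>\<^bsub>UP M\<^esub> quad_poly \<oplus>\<^bsub>UP M\<^esub> (monom (UP M) b 0 \<oplus>\<^bsub>UP M\<^esub> monom (UP M) c 1)"
      using mod_quad_poly[OF p] by metis
    have "pair_eval p = pair_eval q \<otimes>\<^bsub>Q\<^esub> \<zero>\<^bsub>Q\<^esub> \<oplus>\<^bsub>Q\<^esub>
        pair_eval (monom (UP M) b 0 \<oplus>\<^bsub>UP M\<^esub> monom (UP M) c 1)"
      unfolding 1(4) using 1(1-3) by (simp add: pair_eval_quad_poly del: quad_pair_simps(2-))
    also have "\<dots> = \<zero>\<^bsub>Q\<^esub> \<oplus>\<^bsub>Q\<^esub> (b, c)"
      using 1(1-3) Q.r_null[OF hom_closed[OF 1(3)]] by (simp only: pair_eval_linear)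
    finally have "pair_eval p = (b, c)" using 1(1-3) by simp
    then have "b = \<zero>\<^bsub>M\<^esub>" "c = \<zero>\<^bsub>M\<^esub>" using p0 1 by auto
    then show ?thesis using 1 by (auto simp: quad_ideal_eq)
  qed
  moreover have "q \<otimes>\<^bsub>UP M\<^esub> quad_poly \<in> carrier (UP M) \<and> pair_eval (q \<otimes>\<^bsub>UP M\<^esub> quad_poly) = \<zero>\<^bsub>Q\<^esub>"
    if "q \<in> carrier (UP M)" for q
    using that Q.r_null[OF hom_closed[OF that]] pair_eval_quad_poly by (simp only: hom_mult quad_poly_closed P.P.m_closed)
  ultimately show ?thesis
    unfolding a_kernel_def' quad_ideal_eq by blast
qed

end

text \<open>Such a \<open>g\<close> coincides on the carrier with the inverse of the bijection
  \<open>f\<close>. It turns the isomorphism from the quotient to pairs into one given by the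
  explicit map \<open>quad_elt\<close>.\<close>

lemma ring_iso_of_left_inverse:
  assumes "ring R" "f \<in> ring_iso R S" "\<And>y. y \<in> carrier S \<Longrightarrow> g y \<in> carrier R \<and> f (g y) = y"
  shows "g \<in> ring_iso S R"
proof -
  interpret R: ring R by fact
  have f: "bij_betw f (carrier R) (carrier S)" using assms(2) by (simp add: ring_iso_def)
  have g: "g y = inv_into (carrier R) f y" if "y \<in> carrier S" for y
    using inv_into_f_f[of f "carrier R" "g y"] f assms(3)[OF that] by (simp add: bij_betw_def)
  have iso: "inv_into (carrier R) f \<in> ring_iso S R"
    by (rule ring_iso_set_sym[OF assms(1,2)])
  have "bij_betw g (carrier S) (carrier R)"
    using iso bij_betw_cong[of "carrier S" g "inv_into (carrier R) f"] g by (simp add: ring_iso_def)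
  moreover have "g \<in> ring_hom S R"
  proof (rule ring_hom_memI)
    \<comment> \<open>Closure of \<open>S\<close> under its operations is read off from
      \<open>R\<close>, every element of \<open>S\<close> being an image under
      \<open>f\<close>.\<close>
    have S: "x \<oplus>\<^bsub>S\<^esub> y \<in> carrier S" "x \<otimes>\<^bsub>S\<^esub> y \<in> carrier S" "\<one>\<^bsub>S\<^esub> \<in> carrier S"
      if xy: "x \<in> carrier S" "y \<in> carrier S" for x y
    proof -
      have h: "f \<in> ring_hom R S" using assms(2) by (simp add: ring_iso_def)
      obtain x' y' where "x' \<in> carrier R" "y' \<in> carrier R" "x = f x'" "y = f y'"
        using xy f unfolding bij_betw_def by blast
      then show "x \<oplus>\<^bsub>S\<^esub> y \<in> carrier S" "x \<otimes>\<^bsub>S\<^esub> y \<in> carrier S" "\<one>\<^bsub>S\<^esub> \<in> carrier S"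
        using h by (metis R.add.m_closed R.m_closed R.one_closed ring_hom_add ring_hom_mult ring_hom_one ring_hom_closed)+
    qed
    have i: "inv_into (carrier R) f \<in> ring_hom S R" using iso by (simp add: ring_iso_def)
    show "g x \<in> carrier R" if "x \<in> carrier S" for x using that assms(3) by simp
    show "g (x \<otimes>\<^bsub>S\<^esub> y) = g x \<otimes>\<^bsub>R\<^esub> g y" if "x \<in> carrier S" "y \<in> carrier S" for x y
      using that S[OF that] i by (simp add: g ring_hom_mult)
    show "g (x \<oplus>\<^bsub>S\<^esub> y) = g x \<oplus>\<^bsub>R\<^esub> g y" if "x \<in> carrier S" "y \<in> carrier S" for x y
      using that S[OF that] i by (simp add: g ring_hom_add)
    have "\<one>\<^bsub>S\<^esub> \<in> carrier S" using assms(2) by (metis R.one_closed ring_iso_memE(1) ring_iso_memE(4))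
    then show "g \<one>\<^bsub>S\<^esub> = \<one>\<^bsub>R\<^esub>" using i by (simp add: g ring_hom_one)
  qed
  ultimately show ?thesis by (simp add: ring_iso_def)
qed

section \<open>The quotient by x^2 - t identified with pairs\<close>

context quad_algebra
begin

lemma quad_ext_simps [simp]:
  "carrier (quad_ext M t) = carrier (UP M Quot quad_ideal M t)"
  "mult (quad_ext M t) = mult (UP M Quot quad_ideal M t)"
  "add (quad_ext M t) = add (UP M Quot quad_ideal M t)"
  "one (quad_ext M t) = one (UP M Quot quad_ideal M t)"
  "zero (quad_ext M t) = zero (UP M Quot quad_ideal M t)"
  by (simp_all add: quad_ext_def)

lemma pair_eval_ring_hom_ring: "ring_hom_ring (UP M) Q pair_eval"
proof -
  interpret H: ring_hom_cring "UP M" Q pair_eval by (rule pair_eval_hom)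
  show ?thesis by (intro ring_hom_ringI2 H.R.ring_axioms H.S.ring_axioms H.homh)
qed

lemma quad_ideal_ideal: "ideal (quad_ideal M t) (UP M)"
proof -
  interpret H: ring_hom_cring "UP M" Q pair_eval by (rule pair_eval_hom)
  show ?thesis unfolding kernel_pair_eval[symmetric] by (rule ring_hom_ring.kernel_is_ideal[OF pair_eval_ring_hom_ring])
qed

text \<open>The first isomorphism theorem: \<open>pair_eval\<close> is constant on each coset of its
  kernel, so \<open>the_elem\<close> extracts the common value. Polynomials of the form a + b x
  already reach every pair.\<close>

lemma quot_pair_iso:
  "(\<lambda>X. the_elem (pair_eval ` X)) \<in> ring_iso (UP M Quot quad_ideal M t) Q"
proof -
  interpret P: UP_cring M "UP M" by (simp_all add: UP_M_cring)
  interpret H: ring_hom_cring "UP M" Q pair_eval by (rule pair_eval_hom)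
  have "pair_eval ` carrier (UP M) = carrier Q"
  proof
    show "carrier Q \<subseteq> pair_eval ` carrier (UP M)"
    proof
      fix y assume "y \<in> carrier Q"
      then obtain a b where "y = (a, b)" "a \<in> carrier M" "b \<in> carrier M" by auto
      then show "y \<in> pair_eval ` carrier (UP M)"
        using pair_eval_linear[of a b] by (intro image_eqI[of _ _ "monom (UP M) a 0 \<oplus>\<^bsub>UP M\<^esub> monom (UP M) b 1"]) (simp_all del: H.hom_add)
    qed
  qed (use H.hom_closed in blast)
  then show ?thesis unfolding kernel_pair_eval[symmetric] by (rule ring_hom_ring.FactRing_iso_set[OF pair_eval_ring_hom_ring])
qed

lemma pair_of_coset:
  assumes "p \<in> carrier (UP M)"
  shows "the_elem (pair_eval ` (quad_ideal M t +>\<^bsub>UP M\<^esub> p)) = pair_eval p"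
proof -
  interpret H: ring_hom_cring "UP M" Q pair_eval by (rule pair_eval_hom)
  show ?thesis unfolding kernel_pair_eval[symmetric] using assms by (rule ring_hom_ring.the_elem_simp[OF pair_eval_ring_hom_ring])
qed

lemma quot_ring: "ring (UP M Quot quad_ideal M t)"
  by (rule ideal.quotient_is_ring[OF quad_ideal_ideal])

abbreviation "pelt \<equiv> (\<lambda>(a, b). quad_elt M t a b)"

lemma quot_closed:
  "p \<in> carrier (UP M) \<Longrightarrow> quad_ideal M t +>\<^bsub>UP M\<^esub> p \<in> carrier (UP M Quot quad_ideal M t)"
  by (rule ring_hom_closed[OF ideal.rcos_ring_hom[OF quad_ideal_ideal]])

lemma quad_elt_coset:
  assumes "a \<in> carrier M" "b \<in> carrier M"
  shows "quad_elt M t a b \<in> carrier (UP M Quot quad_ideal M t)"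
    "the_elem (pair_eval ` quad_elt M t a b) = (a, b)"
proof -
  interpret P: UP_cring M "UP M" by (simp_all add: UP_M_cring)
  have "monom (UP M) a 0 \<oplus>\<^bsub>UP M\<^esub> monom (UP M) b 1 \<in> carrier (UP M)" using assms by simp
  then show "quad_elt M t a b \<in> carrier (UP M Quot quad_ideal M t)"
    "the_elem (pair_eval ` quad_elt M t a b) = (a, b)"
    using assms by (simp_all only: quad_elt_def quot_closed pair_of_coset pair_eval_linear)
qed

lemma pelt_ring_iso: "pelt \<in> ring_iso Q (quad_ext M t)"
proof -
  have "pelt y \<in> carrier (UP M Quot quad_ideal M t) \<and> the_elem (pair_eval ` pelt y) = y"
    if "y \<in> carrier Q" for y
  proof -
    from that obtain a b where y: "y = (a, b)" "a \<in> carrier M" "b \<in> carrier M" by auto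
    show ?thesis unfolding y(1) prod.case using quad_elt_coset[OF y(2,3)] by (rule conjI)
  qed
  then have "pelt \<in> ring_iso Q (UP M Quot quad_ideal M t)"
    by (rule ring_iso_of_left_inverse[OF quot_ring quot_pair_iso])
  then show ?thesis by (simp only: ring_iso_def ring_hom_def quad_ext_simps)
qed

lemma quad_elt_inject:
  assumes "a \<in> carrier M" "b \<in> carrier M" "a' \<in> carrier M" "b' \<in> carrier M"
    and "quad_elt M t a b = quad_elt M t a' b'"
  shows "a = a' \<and> b = b'"
  using quad_elt_coset(2)[OF assms(1,2)] quad_elt_coset(2)[OF assms(3,4)] unfolding assms(5) by simp

lemma quad_ext_carrier: "carrier (quad_ext M t) = {quad_elt M t a b | a b. a \<in> carrier M \<and> b \<in> carrier M}"
proof -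
  have "carrier (quad_ext M t) = pelt ` carrier Q"
    using pelt_ring_iso unfolding ring_iso_def bij_betw_def by blast
  also have "\<dots> = {quad_elt M t a b | a b. a \<in> carrier M \<and> b \<in> carrier M}"
    unfolding quad_pair_simps(1) by force
  finally show ?thesis .
qed

text \<open>The map from cosets to pairs is injective, so a coset is determined by the value of
  \<open>pair_eval\<close> at any representative.\<close>

lemma coset_eq_pelt:
  assumes "p \<in> carrier (UP M)"
  shows "quad_ideal M t +>\<^bsub>UP M\<^esub> p = pelt (pair_eval p)"
proof -
  interpret H: ring_hom_cring "UP M" Q pair_eval by (rule pair_eval_hom)
  obtain a b where ab: "pair_eval p = (a, b)" "a \<in> carrier M" "b \<in> carrier M"
    using H.hom_closed[OF assms] by auto
  have "inj_on (\<lambda>X. the_elem (pair_eval ` X)) (carrier (UP M Quot quad_ideal M t))"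
    using quot_pair_iso by (simp add: ring_iso_def bij_betw_def)
  then have "quad_ideal M t +>\<^bsub>UP M\<^esub> p = quad_elt M t a b"
    by (rule inj_onD) (use ab assms in \<open>simp_all add: quot_closed quad_elt_coset pair_of_coset\<close>)
  then show ?thesis using ab by simp
qed

text \<open>\<open>quad_map\<close> is defined through all polynomials of a class, so
  \<open>pair_eval\<close> must be known at an arbitrary member and not only at a + b x.\<close>

lemma mem_quad_elt:
  assumes "a \<in> carrier M" "b \<in> carrier M" "p \<in> quad_elt M t a b"
  shows "p \<in> carrier (UP M)" "pair_eval p = (a, b)"
proof -
  interpret P: UP_cring M "UP M" by (simp_all add: UP_M_cring)
  interpret I: ideal "quad_ideal M t" "UP M" by (rule quad_ideal_ideal)
  let ?r = "monom (UP M) a 0 \<oplus>\<^bsub>UP M\<^esub> monom (UP M) b 1"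
  have r: "?r \<in> carrier (UP M)" using assms by simp
  have p: "p \<in> quad_ideal M t +>\<^bsub>UP M\<^esub> ?r" using assms by (simp add: quad_elt_def)
  show c: "p \<in> carrier (UP M)" using P.P.a_r_coset_subset_G[OF I.a_subset r] p by auto
  have "quad_ideal M t +>\<^bsub>UP M\<^esub> p = quad_elt M t a b"
    using P.P.a_repr_independence[OF p r I.additive_subgroup_axioms[THEN additive_subgroup.a_subgroup]]
    by (simp add: quad_elt_def)
  then show "pair_eval p = (a, b)"
    using pair_of_coset[OF c] quad_elt_coset(2)[OF assms(1,2)] by simp
qed

lemma quad_elt_nonempty:
  assumes "a \<in> carrier M" "b \<in> carrier M"
  shows "quad_elt M t a b \<noteq> {}"
proof -
  interpret P: UP_cring M "UP M" by (simp_all add: UP_M_cring)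
  interpret I: ideal "quad_ideal M t" "UP M" by (rule quad_ideal_ideal)
  show ?thesis
    using I.a_rcos_self[of "monom (UP M) a 0 \<oplus>\<^bsub>UP M\<^esub> monom (UP M) b 1"] assms
    by (auto simp: quad_elt_def)
qed

lemma quad_ext_algebra: "algebra R (quad_ext M t)"
proof -
  interpret P: UP_cring M "UP M" by (simp_all add: UP_M_cring)
  have "(+>\<^bsub>UP M\<^esub>) (quad_ideal M t) \<circ> ((\<lambda>a. monom (UP M) a 0) \<circ> base_map M) \<in>
      ring_hom R (UP M Quot quad_ideal M t)"
    by (intro ring_hom_trans[OF _ ideal.rcos_ring_hom[OF quad_ideal_ideal]]
        ring_hom_trans[OF base_map_hom P.const_ring_hom])
  then show ?thesis
    unfolding quad_ext_def
    by (intro alg_via_algebra R_cring ideal.quotient_is_cring quad_ideal_ideal) (simp_all add: comp_def P.is_cring)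
qed

lemma quad_ext_base_map:
  assumes "c \<in> carrier R"
  shows "base_map (quad_ext M t) c = quad_elt M t (base_map M c) \<zero>\<^bsub>M\<^esub>"
proof -
  interpret P: UP_cring M "UP M" by (simp_all add: UP_M_cring)
  interpret F: ring "UP M Quot quad_ideal M t" by (rule quot_ring)
  have "quad_ideal M t +>\<^bsub>UP M\<^esub> monom (UP M) (base_map M c) 0 \<in> carrier (UP M Quot quad_ideal M t)"
    using assms by (intro quot_closed) simp
  then show ?thesis
    using assms unfolding base_map_def[of "quad_ext M t"] by (simp add: quad_ext_def quad_elt_def)
qed

lemma pelt_alg_iso: "pelt \<in> alg_iso R Q (quad_ext M t)"
proof -
  have "pelt \<in> alg_hom R Q (quad_ext M t)"
    using pelt_ring_iso
    by (intro alg_hom_of_base_map quad_pair_algebra quad_ext_algebra)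
      (auto simp: ring_iso_def quad_pair_base_map quad_ext_base_map)
  then show ?thesis using pelt_ring_iso by (simp add: alg_iso_def ring_iso_def)
qed

text \<open>Uniqueness of the representative a + b x reduces the set in the definition of
  \<open>quad_inv\<close> to a singleton.\<close>

lemma quad_inv_quad_elt:
  assumes "a \<in> carrier M" "b \<in> carrier M"
  shows "quad_inv M t \<theta> (quad_elt M t a b) = quad_elt M t (\<theta> a) (\<ominus>\<^bsub>M\<^esub> \<theta> b)"
proof -
  have "{quad_elt M t (\<theta> a') (\<ominus>\<^bsub>M\<^esub> \<theta> b') | a' b'.
      a' \<in> carrier M \<and> b' \<in> carrier M \<and> quad_elt M t a b = quad_elt M t a' b'} =
      {quad_elt M t (\<theta> a) (\<ominus>\<^bsub>M\<^esub> \<theta> b)}"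
    using assms quad_elt_inject[of a b] by blast
  then show ?thesis unfolding quad_inv_def by simp
qed

end

text \<open>Changing the sign of x respects the product because x^2 = t: the two signs cancel in the
  term b d, and \<theta> fixes the image of \<open>t\<close> since it comes from
  \<open>k\<close>.\<close>

lemma involution_pair:
  assumes "quad_algebra k M t" "involution k M \<theta>"
  shows "involution k (quad_pair M t) (\<lambda>(a, b). (\<theta> a, \<ominus>\<^bsub>M\<^esub> \<theta> b))"
proof -
  interpret quad_algebra k M t by fact
  have \<theta>: "\<theta> \<in> alg_hom k M M" "\<And>x. x \<in> carrier M \<Longrightarrow> \<theta> (\<theta> x) = x"
    using assms(2) by (auto simp: involution_def alg_iso_def)
  have h: "\<theta> \<in> ring_hom M M" using \<theta>(1) by (simp add: alg_hom_def)
  interpret \<theta>: ring_hom_cring M M \<theta> using h M_cring by (intro ring_hom_cringI)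
  have base: "\<theta> (base_map M c) = base_map M c" if "c \<in> carrier k" for c
    using alg_hom_base_map[OF algebra_axioms \<theta>(1) that] .
  let ?\<sigma> = "\<lambda>(a, b). (\<theta> a, \<ominus>\<^bsub>M\<^esub> \<theta> b)"
  have inv: "?\<sigma> x \<in> carrier Q \<and> ?\<sigma> (?\<sigma> x) = x" if "x \<in> carrier Q" for x
    using that \<theta>(2) by auto
  have "?\<sigma> \<in> ring_hom Q Q"
  proof (rule ring_hom_memI)
    show "?\<sigma> (x \<otimes>\<^bsub>Q\<^esub> y) = ?\<sigma> x \<otimes>\<^bsub>Q\<^esub> ?\<sigma> y" if xy: "x \<in> carrier Q" "y \<in> carrier Q" for x y
    proof -
      obtain a b c d where "x = (a, b)" "y = (c, d)" "a \<in> carrier M" "b \<in> carrier M" "c \<in> carrier M" "d \<in> carrier M"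
        using xy by auto
      then show ?thesis by (simp add: base r_minus l_minus M.minus_add)
    qed
  qed (auto simp: M.minus_add)
  then have "?\<sigma> \<in> alg_hom k Q Q"
    by (intro alg_hom_of_base_map quad_pair_algebra) (auto simp: quad_pair_base_map base)
  moreover have "bij_betw ?\<sigma> (carrier Q) (carrier Q)"
    using inv by (intro bij_betw_byWitness[where f' = ?\<sigma>]) blast+
  ultimately show ?thesis using inv by (simp add: involution_def alg_iso_def)
qed

text \<open>On the carrier of \<open>N\<close> the map \<tau> is the conjugate of \<sigma> by
  \<open>f\<close>, and conjugation carries fixed points to fixed points. It is applied with
  \<open>f\<close> sending a pair to its class.\<close>

lemma involution_transport:
  assumes "algebra k M" "f \<in> alg_iso k M N" "involution k M \<sigma>"
    and "\<And>x. x \<in> carrier M \<Longrightarrow> \<tau> (f x) = f (\<sigma> x)" "algebra k N"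
  shows "involution k N \<tau>" "f \<in> alg_iso k (fixed_alg M \<sigma>) (fixed_alg N \<tau>)"
proof -
  let ?g = "inv_into (carrier M) f"
  have \<sigma>: "\<sigma> \<in> alg_iso k M M" "\<And>x. x \<in> carrier M \<Longrightarrow> \<sigma> (\<sigma> x) = x" "\<And>x. x \<in> carrier M \<Longrightarrow> \<sigma> x \<in> carrier M"
    using assms(3) by (auto simp: involution_def alg_iso_def bij_betw_def)
  have f: "inj_on f (carrier M)" "f ` carrier M = carrier N"
    using assms(2) by (auto simp: alg_iso_def bij_betw_def)
  have "f \<circ> (\<sigma> \<circ> ?g) \<in> alg_iso k N N"
    using assms(2) \<sigma>(1) alg_iso_inv[OF assms(1,2)] alg_iso_comp by metis
  moreover have "\<tau> y = (f \<circ> (\<sigma> \<circ> ?g)) y" if "y \<in> carrier N" for y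
    using that f assms(4)[of "?g y"] by (simp add: f_inv_into_f inv_into_into)
  ultimately have "\<tau> \<in> alg_iso k N N" using alg_iso_cong[OF assms(5)] by blast
  moreover have "\<tau> (\<tau> y) = y" if "y \<in> carrier N" for y
  proof -
    from that f obtain x where "x \<in> carrier M" "y = f x" by auto
    then show ?thesis using assms(4) \<sigma> by simp
  qed
  ultimately show "involution k N \<tau>" by (simp add: involution_def)
  have "f ` fixed_set M \<sigma> = fixed_set N \<tau>"
  proof
    show "fixed_set N \<tau> \<subseteq> f ` fixed_set M \<sigma>"
    proof
      fix y assume y: "y \<in> fixed_set N \<tau>"
      then obtain x where x: "x \<in> carrier M" "y = f x" using f by (auto simp: fixed_set_def)
      then have "f (\<sigma> x) = f x" using y assms(4) by (simp add: fixed_set_def)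
      then have "\<sigma> x = x" using f(1) x \<sigma>(3) by (meson inj_onD)
      then show "y \<in> f ` fixed_set M \<sigma>" using x by (auto simp: fixed_set_def)
    qed
  qed (use assms(4) f(2) in \<open>auto simp: fixed_set_def\<close>)
  then have "bij_betw f (fixed_set M \<sigma>) (fixed_set N \<tau>)"
    using f(1) by (auto simp: bij_betw_def fixed_set_def intro: inj_on_subset)
  moreover have "fixed_set M \<sigma> \<subseteq> carrier M" by (auto simp: fixed_set_def)
  ultimately show "f \<in> alg_iso k (fixed_alg M \<sigma>) (fixed_alg N \<tau>)"
    using assms(2)
    by (auto simp: alg_iso_def alg_hom_def ring_hom_def fixed_alg_def subset_iff bij_betw_def)
qed

lemma quad_inv_involution:
  assumes "quad_algebra k M t" "involution k M \<theta>"
  shows "involution k (quad_ext M t) (quad_inv M t \<theta>)"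
    "(\<lambda>(a, b). quad_elt M t a b) \<in> alg_iso k
      (fixed_alg (quad_pair M t) (\<lambda>(a, b). (\<theta> a, \<ominus>\<^bsub>M\<^esub> \<theta> b))) (fixed_alg (quad_ext M t) (quad_inv M t \<theta>))"
proof -
  interpret quad_algebra k M t by fact
  show "involution k (quad_ext M t) (quad_inv M t \<theta>)"
    "(\<lambda>(a, b). quad_elt M t a b) \<in> alg_iso k
      (fixed_alg (quad_pair M t) (\<lambda>(a, b). (\<theta> a, \<ominus>\<^bsub>M\<^esub> \<theta> b))) (fixed_alg (quad_ext M t) (quad_inv M t \<theta>))"
    using involution_transport[OF quad_pair_algebra pelt_alg_iso involution_pair[OF assms] _ quad_ext_algebra]
    by (auto simp: quad_inv_quad_elt)
qed

context quad_algebra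
begin

text \<open>Every class comes from a pair, and pairs multiply like their classes, so a homomorphism
  out of the quotient may be checked on pairs.\<close>

lemma quad_ext_homI:
  assumes "g \<in> ring_hom Q S" "\<And>a b. a \<in> carrier M \<Longrightarrow> b \<in> carrier M \<Longrightarrow> f (quad_elt M t a b) = g (a, b)"
  shows "f \<in> ring_hom (quad_ext M t) S"
proof -
  have p: "pelt \<in> ring_hom Q (quad_ext M t)" using pelt_ring_iso by (simp add: ring_iso_def)
  interpret Q: cring Q by (rule quad_pair_cring)
  have fg: "f (pelt y) = g y" if "y \<in> carrier Q" for y using that assms(2) by auto
  have car: "\<exists>y\<in>carrier Q. x = pelt y" if "x \<in> carrier (quad_ext M t)" for x
    using that unfolding quad_ext_carrier by force
  show ?thesis
  proof (rule ring_hom_memI)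
    fix x y assume "x \<in> carrier (quad_ext M t)" "y \<in> carrier (quad_ext M t)"
    then obtain u v where uv: "u \<in> carrier Q" "v \<in> carrier Q" "x = pelt u" "y = pelt v"
      using car by meson
    show "f x \<in> carrier S" unfolding uv fg[OF uv(1)] by (rule ring_hom_closed[OF assms(1) uv(1)])
    show "f (x \<otimes>\<^bsub>quad_ext M t\<^esub> y) = f x \<otimes>\<^bsub>S\<^esub> f y"
      unfolding uv ring_hom_mult[OF p uv(1,2), symmetric] fg[OF uv(1)] fg[OF uv(2)] fg[OF Q.m_closed[OF uv(1,2)]]
      by (rule ring_hom_mult[OF assms(1) uv(1,2)])
    show "f (x \<oplus>\<^bsub>quad_ext M t\<^esub> y) = f x \<oplus>\<^bsub>S\<^esub> f y"
      unfolding uv ring_hom_add[OF p uv(1,2), symmetric] fg[OF uv(1)] fg[OF uv(2)] fg[OF Q.a_closed[OF uv(1,2)]]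
      by (rule ring_hom_add[OF assms(1) uv(1,2)])
  next
    show "f \<one>\<^bsub>quad_ext M t\<^esub> = \<one>\<^bsub>S\<^esub>"
      unfolding ring_hom_one[OF p, symmetric] fg[OF Q.one_closed] by (rule ring_hom_one[OF assms(1)])
  qed
qed

end

lemma self_alg_algebra: "cring k \<Longrightarrow> algebra k (self_alg k)"
  unfolding self_alg_def by (intro alg_via_algebra) (auto intro: ring_hom_memI)

lemma self_alg_simps [simp]:
  "carrier (self_alg k) = carrier k" "mult (self_alg k) = mult k" "one (self_alg k) = one k"
  "zero (self_alg k) = zero k" "add (self_alg k) = add k" "a_inv (self_alg k) = a_inv k"
  by (simp_all add: self_alg_def)

lemma (in cring) base_map_self_alg [simp]: "c \<in> carrier R \<Longrightarrow> base_map (self_alg R) c = c"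
  by (simp add: base_map_def self_alg_def)

section \<open>The canonical map from k[x]/(x^2 - t)\<close>

context quad_algebra
begin

lemma self_alg_quad_algebra: "quad_algebra R (self_alg R) t"
  by (intro quad_algebra.intro self_alg_algebra R_cring quad_algebra_axioms.intro t_closed)

abbreviation "pair_base \<equiv> (\<lambda>(a, b). (base_map M a, base_map M b))"

lemma pair_base_hom: "pair_base \<in> ring_hom (quad_pair (self_alg R) t) Q"
  using base_map_hom
  by (intro ring_hom_memI) (auto simp: ring_hom_add ring_hom_mult ring_hom_one ring_hom_zero[OF base_map_hom R.ring_axioms ring_axioms])

text \<open>A commuting square, checked on monomials: changing coefficients and evaluating may be
  interchanged. Membership in \<open>UP M\<close> is carried through the same induction because
  additivity of \<open>pair_eval\<close> requires it.\<close>

lemma base_map_poly: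
  assumes "p \<in> carrier (UP (self_alg R))"
  shows "(\<lambda>n. base_map M (p n)) \<in> carrier (UP M) \<and>
    pair_eval (\<lambda>n. base_map M (p n)) = pair_base (quad_algebra.pair_eval (self_alg R) t p)"
proof -
  interpret k: quad_algebra R "self_alg R" t by (rule self_alg_quad_algebra)
  interpret Pk: UP_cring "self_alg R" "UP (self_alg R)" by (simp_all add: k.UP_M_cring)
  interpret P: UP_cring M "UP M" by (simp_all add: UP_M_cring)
  interpret Hk: ring_hom_cring "UP (self_alg R)" k.Q k.pair_eval by (rule k.pair_eval_hom)
  interpret H: ring_hom_cring "UP M" Q pair_eval by (rule pair_eval_hom)
  interpret B: ring_hom_cring k.Q Q pair_base
    by (intro ring_hom_cringI k.quad_pair_cring quad_pair_cring pair_base_hom)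
  have base0: "base_map M \<zero> = \<zero>\<^bsub>M\<^esub>"
    by (rule ring_hom_zero[OF base_map_hom R.ring_axioms ring_axioms])
  from assms show ?thesis
  proof (induction rule: Pk.UP_induct)
    case zero
    have "(\<lambda>n. base_map M (\<zero>\<^bsub>UP (self_alg R)\<^esub> n)) = \<zero>\<^bsub>UP M\<^esub>"
      by (simp add: UP_def base0)
    then show ?case by (simp only: P.P.zero_closed H.hom_zero Hk.hom_zero B.hom_zero simp_thms)
  next
    case (add a n p)
    let ?p = "\<lambda>n. base_map M (p n)"
    have a: "a \<in> carrier R" using add by simp
    have p: "p m \<in> carrier R" for m using add Pk.coeff_closed[of p m] by (simp add: UP_def)
    have eq: "(\<lambda>i. base_map M ((monom (UP (self_alg R)) a n \<oplus>\<^bsub>UP (self_alg R)\<^esub> p) i)) =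
        monom (UP M) (base_map M a) n \<oplus>\<^bsub>UP M\<^esub> ?p"
    proof -
      have up: "monom (UP (self_alg R)) a n \<in> up (self_alg R)" "p \<in> up (self_alg R)"
        "monom (UP M) (base_map M a) n \<in> up M" "?p \<in> up M"
        using add a Pk.monom_closed P.monom_closed[of "base_map M a" n] by (auto simp: UP_def)
      show "(\<lambda>i. base_map M ((monom (UP (self_alg R)) a n \<oplus>\<^bsub>UP (self_alg R)\<^esub> p) i)) =
        monom (UP M) (base_map M a) n \<oplus>\<^bsub>UP M\<^esub> ?p"
        using up a p by (auto simp: UP_def base0 ring_hom_add[OF base_map_hom])
    qed
    \<comment> \<open>\<open>pair_base\<close> sends constants to constants and x to x, hence a
      power of x to the same power of x.\<close>
    have "pair_eval (monom (UP M) (base_map M a) n) = pair_base (k.pair_eval (monom (UP (self_alg R)) a n))"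
    proof -
      have "pair_base ((a, \<zero>) \<otimes>\<^bsub>k.Q\<^esub> (\<zero>, \<one>) [^]\<^bsub>k.Q\<^esub> n) =
          pair_base (a, \<zero>) \<otimes>\<^bsub>Q\<^esub> pair_base (\<zero>, \<one>) [^]\<^bsub>Q\<^esub> n"
        using a B.hom_mult[of "(a, \<zero>)" "(\<zero>, \<one>) [^]\<^bsub>k.Q\<^esub> n"] B.hom_pow[of "(\<zero>, \<one>)" n]
          Hk.S.nat_pow_closed[of "(\<zero>, \<one>)" n]
        by (simp del: quad_pair_simps(2-))
      then show ?thesis using a
        by (simp add: pair_eval_monom_pow k.pair_eval_monom_pow base0 ring_hom_one[OF base_map_hom] del: quad_pair_simps)
    qed
    moreover have "k.pair_eval (monom (UP (self_alg R)) a n) \<in> carrier k.Q" "k.pair_eval p \<in> carrier k.Q"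
      using add by (intro Hk.hom_closed; simp)+
    ultimately show ?case
      unfolding eq using add a
      by (simp only: H.hom_add Hk.hom_add B.hom_add P.monom_closed base_map_closed P.P.a_closed Pk.monom_closed simp_thms)
  qed
qed

lemma quad_map_quad_elt:
  assumes "a \<in> carrier R" "b \<in> carrier R"
  shows "quad_map M t (quad_elt (self_alg R) t a b) = quad_elt M t (base_map M a) (base_map M b)"
proof -
  interpret k: quad_algebra R "self_alg R" t by (rule self_alg_quad_algebra)
  have "quad_ideal M t +>\<^bsub>UP M\<^esub> (\<lambda>n. base_map M (p n)) = quad_elt M t (base_map M a) (base_map M b)"
    if "p \<in> quad_elt (self_alg R) t a b" for p
  proof -
    have p: "p \<in> carrier (UP (self_alg R))" "k.pair_eval p = (a, b)"
      using k.mem_quad_elt[OF _ _ that] assms by simp_all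
    show ?thesis using base_map_poly[OF p(1)] coset_eq_pelt[of "\<lambda>n. base_map M (p n)"] p(2) by simp
  qed
  \<comment> \<open>For an empty class the image would be empty and \<open>the_elem\<close> would
    give no information.\<close>
  moreover have "quad_elt (self_alg R) t a b \<noteq> {}" using assms by (intro k.quad_elt_nonempty) simp_all
  ultimately have "(\<lambda>p. quad_ideal M t +>\<^bsub>UP M\<^esub> (\<lambda>n. base_map M (p n))) ` quad_elt (self_alg R) t a b =
      {quad_elt M t (base_map M a) (base_map M b)}"
    by (auto simp: image_iff)
  then show ?thesis by (simp add: quad_map_def)
qed

lemma quad_map_ring_hom: "quad_map M t \<in> ring_hom (quad_ext (self_alg R) t) (quad_ext M t)"
proof -
  interpret k: quad_algebra R "self_alg R" t by (rule self_alg_quad_algebra)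
  have "pelt \<in> ring_hom Q (quad_ext M t)" using pelt_ring_iso by (simp add: ring_iso_def)
  then have "pelt \<circ> pair_base \<in> ring_hom k.Q (quad_ext M t)"
    using pair_base_hom by (rule ring_hom_trans[rotated])
  then show ?thesis by (rule k.quad_ext_homI) (simp add: quad_map_quad_elt)
qed

lemma quad_map_alg_hom: "quad_map M t \<in> alg_hom R (quad_ext (self_alg R) t) (quad_ext M t)"
proof -
  interpret k: quad_algebra R "self_alg R" t by (rule self_alg_quad_algebra)
  have base0: "base_map M \<zero> = \<zero>\<^bsub>M\<^esub>"
    by (rule ring_hom_zero[OF base_map_hom R.ring_axioms ring_axioms])
  show ?thesis
    by (intro alg_hom_of_base_map k.quad_ext_algebra quad_ext_algebra quad_map_ring_hom)
      (simp add: quad_ext_base_map k.quad_ext_base_map quad_map_quad_elt base0)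
qed

text \<open>\<theta> fixes the image of \<open>k\<close>, so on classes coming from \<open>k\<close>
  both involutions only change the sign of x.\<close>

lemma quad_map_quad_inv:
  assumes "involution R M \<theta>" "\<alpha> \<in> carrier (quad_ext (self_alg R) t)"
  shows "quad_map M t (quad_inv (self_alg R) t (\<lambda>a. a) \<alpha>) = quad_inv M t \<theta> (quad_map M t \<alpha>)"
proof -
  interpret k: quad_algebra R "self_alg R" t by (rule self_alg_quad_algebra)
  have base: "\<theta> (base_map M c) = base_map M c" if "c \<in> carrier R" for c
    by (rule alg_hom_base_map[OF algebra_axioms _ that]) (use assms(1) in \<open>simp add: involution_def alg_iso_def\<close>)
  obtain a b where ab: "\<alpha> = quad_elt (self_alg R) t a b" "a \<in> carrier R" "b \<in> carrier R"
    using assms(2) unfolding k.quad_ext_carrier by auto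
  interpret b: ring_hom_cring R M "base_map M" by (rule base_map_ring_hom_cring)
  show ?thesis unfolding ab(1) using ab(2,3)
    by (simp add: k.quad_inv_quad_elt quad_map_quad_elt quad_inv_quad_elt base)
qed

end

section \<open>The contraction algebra\<close>

locale involutive_quad_algebra = quad_algebra +
  fixes \<theta>
  assumes \<theta>_involution: "involution R M \<theta>"
    and t_unit: "t \<in> Units R"
begin

lemma \<theta>_ring_hom_cring: "ring_hom_cring M M \<theta>"
  using \<theta>_involution M_cring
  by (intro ring_hom_cringI) (auto simp: involution_def alg_iso_def alg_hom_def)

sublocale \<theta>: ring_hom_cring M M \<theta> by (rule \<theta>_ring_hom_cring)

lemma \<theta>_base_map: "c \<in> carrier R \<Longrightarrow> \<theta> (base_map M c) = base_map M c"
  using \<theta>_involution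
  by (intro alg_hom_base_map[OF algebra_axioms]) (auto simp: involution_def alg_iso_def)

lemma \<theta>_\<theta>: "a \<in> carrier M \<Longrightarrow> \<theta> (\<theta> a) = a"
  using \<theta>_involution by (simp add: involution_def)

abbreviation "\<sigma> \<equiv> (\<lambda>(a, b). (\<theta> a, \<ominus>\<^bsub>M\<^esub> \<theta> b))"

lemma fixed_set_pair_iff:
  "(a, b) \<in> fixed_set Q \<sigma> \<longleftrightarrow> a \<in> fixed_set M \<theta> \<and> b \<in> anti_fixed_set M \<theta>"
proof -
  have "\<ominus>\<^bsub>M\<^esub> \<theta> b = b \<longleftrightarrow> \<theta> b = \<ominus>\<^bsub>M\<^esub> b" if "b \<in> carrier M"
    using that by (metis M.minus_minus \<theta>.hom_closed)
  then show ?thesis by (auto simp: fixed_set_def anti_fixed_set_def)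
qed

lemma fixed_pair_subring: "subring (fixed_set Q \<sigma>) Q"
proof -
  interpret Q: cring Q by (rule quad_pair_cring)
  have s: "\<sigma> \<in> ring_hom Q Q"
    using involution_pair[OF quad_algebra_axioms \<theta>_involution]
    by (simp add: involution_def alg_iso_def alg_hom_def)
  interpret s: ring_hom_cring Q Q \<sigma> by (intro ring_hom_cringI Q.is_cring s)
  show ?thesis
    by (rule Q.subringI)
      (simp_all only: fixed_set_def mem_Collect_eq s.hom_mult s.hom_add s.hom_one s.hom_a_inv
        Q.a_closed Q.m_closed Q.one_closed Q.a_inv_closed simp_thms, blast)
qed

abbreviation "Qfix \<equiv> fixed_alg Q \<sigma>"

lemma fixed_pair_simps:
  "carrier Qfix = fixed_set Q \<sigma>" "mult Qfix = mult Q" "add Qfix = add Q" "one Qfix = one Q"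
  "zero Qfix = zero Q" "smult Qfix = smult Q"
  by (simp_all add: fixed_alg_def)

lemma fixed_pair_cring: "cring Qfix"
  using cring.subcringI'[OF quad_pair_cring fixed_pair_subring]
    ring.subcring_iff[OF cring.axioms(1)[OF quad_pair_cring], of "fixed_set Q \<sigma>"]
    subringE(1)[OF fixed_pair_subring]
  by (simp add: fixed_alg_def)

definition "t_inv = base_map M (inv t)"
abbreviation "\<tau> \<equiv> base_map M t"

lemma t_inv_closed [simp]: "t_inv \<in> carrier M"
  using t_unit by (simp add: t_inv_def)

lemma t_t_inv: "\<tau> \<otimes>\<^bsub>M\<^esub> t_inv = \<one>\<^bsub>M\<^esub>"
  using t_unit ring_hom_mult[OF base_map_hom, of t "inv t"] ring_hom_one[OF base_map_hom]
  by (simp add: t_inv_def)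

section \<open>Evaluating the square root of the variable at x\<close>

abbreviation "L \<equiv> laurent_ring M"
abbreviation "lmon \<equiv> laurent_monom M"

text \<open>Negative powers of x make sense in the group of units, hence the integer power in
  \<open>units_of Q\<close>.\<close>

definition "root_pow n = (\<zero>\<^bsub>M\<^esub>, \<one>\<^bsub>M\<^esub>) [^]\<^bsub>units_of Q\<^esub> (n::int)"

text \<open>Since x^2 = t, the inverse of x is x / t, the pair with entries 0 and
  \<open>t_inv\<close>.\<close>

lemma root_unit: "(\<zero>\<^bsub>M\<^esub>, \<one>\<^bsub>M\<^esub>) \<in> Units Q"
  using t_t_inv by (auto simp: Units_def m_comm[of t_inv] intro!: bexI[of _ "(\<zero>\<^bsub>M\<^esub>, t_inv)"])

lemma root_pow:
  "root_pow n \<in> carrier Q" "root_pow 0 = \<one>\<^bsub>Q\<^esub>" "root_pow (m + n) = root_pow m \<otimes>\<^bsub>Q\<^esub> root_pow n"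
  "root_pow 1 = (\<zero>\<^bsub>M\<^esub>, \<one>\<^bsub>M\<^esub>)"
proof -
  interpret Q: cring Q by (rule quad_pair_cring)
  interpret U: group "units_of Q" by (rule Q.units_group)
  have X: "(\<zero>\<^bsub>M\<^esub>, \<one>\<^bsub>M\<^esub>) \<in> carrier (units_of Q)" using root_unit by (simp only: units_of_carrier)
  have "root_pow n \<in> carrier (units_of Q)" unfolding root_pow_def by (rule U.int_pow_closed[OF X])
  then show "root_pow n \<in> carrier Q" unfolding units_of_carrier by (rule Q.Units_closed)
  show "root_pow 0 = \<one>\<^bsub>Q\<^esub>" unfolding root_pow_def by (simp only: int_pow_0 units_of_one)
  show "root_pow (m + n) = root_pow m \<otimes>\<^bsub>Q\<^esub> root_pow n"
    unfolding root_pow_def U.int_pow_mult[OF X] units_of_mult ..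
  show "root_pow 1 = (\<zero>\<^bsub>M\<^esub>, \<one>\<^bsub>M\<^esub>)" unfolding root_pow_def by (rule U.int_pow_1[OF X])
qed

text \<open>Besides 0, only these two exponents occur among the generators and the variable
  (\<surd>t)^2.\<close>

lemma root_pow_values: "root_pow 2 = (\<tau>, \<zero>\<^bsub>M\<^esub>)" "root_pow (-1) = (\<zero>\<^bsub>M\<^esub>, t_inv)"
proof -
  interpret Q: cring Q by (rule quad_pair_cring)
  have "root_pow 2 = root_pow 1 \<otimes>\<^bsub>Q\<^esub> root_pow 1" using root_pow(3)[of 1 1] by simp
  then show "root_pow 2 = (\<tau>, \<zero>\<^bsub>M\<^esub>)" by (simp add: root_pow(4))
  have 1: "root_pow (-1) \<otimes>\<^bsub>Q\<^esub> root_pow 1 = \<one>\<^bsub>Q\<^esub>" using root_pow(3)[of "-1" 1] root_pow(2) by simp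
  have 2: "root_pow 1 \<otimes>\<^bsub>Q\<^esub> (\<zero>\<^bsub>M\<^esub>, t_inv) = \<one>\<^bsub>Q\<^esub>" using t_t_inv by (simp add: root_pow(4))
  have "(\<zero>\<^bsub>M\<^esub>, t_inv) \<in> carrier Q" by simp
  then show "root_pow (-1) = (\<zero>\<^bsub>M\<^esub>, t_inv)"
    using Q.inv_unique[OF 1 2 root_pow(1) root_pow(1)] by simp
qed

definition "\<Phi> = laurent_eval M Q (\<lambda>a. (a, \<zero>\<^bsub>M\<^esub>)) root_pow"

lemma \<Phi>_eval_hom: "laurent_eval_hom M Q (\<lambda>a. (a, \<zero>\<^bsub>M\<^esub>)) root_pow"
  by (intro laurent_eval_hom.intro quad_pair_const_hom laurent_eval_hom_axioms.intro root_pow)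

lemma \<Phi>_hom: "\<Phi> \<in> ring_hom L Q"
  unfolding \<Phi>_def by (rule laurent_eval_hom.ev_hom[OF \<Phi>_eval_hom])

lemma \<Phi>_monom:
  assumes "a \<in> carrier M"
  shows "\<Phi> (lmon a 0) = (a, \<zero>\<^bsub>M\<^esub>)" "\<Phi> (lmon a 2) = (a \<otimes>\<^bsub>M\<^esub> \<tau>, \<zero>\<^bsub>M\<^esub>)" "\<Phi> (lmon a (-1)) = (\<zero>\<^bsub>M\<^esub>, a \<otimes>\<^bsub>M\<^esub> t_inv)"
  unfolding \<Phi>_def laurent_eval_hom.ev_monom[OF \<Phi>_eval_hom assms] root_pow_values root_pow(2)
  using assms by simp_all

section \<open>The contraction algebra inside the Laurent polynomials\<close>

abbreviation "ev_t \<equiv> eval R L (\<lambda>c. lmon (base_map M c) 0) (lmon \<one>\<^bsub>M\<^esub> 2)"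
abbreviation "LA \<equiv> laurent_alg R M"
abbreviation "C \<equiv> contraction_alg R M \<theta>"
abbreviation "gens \<equiv> (\<lambda>a. lmon a 0) ` fixed_set M \<theta> \<union> (\<lambda>a. lmon a (-1)) ` anti_fixed_set M \<theta>"

lemma M_laurent_cring: "cring L"
  using cring.laurent_cring[OF M_cring] .

lemma lmon_closed: "a \<in> carrier M \<Longrightarrow> lmon a n \<in> carrier L"
  by (rule cring.laurent_monom_closed[OF M_cring])

lemma lmon_mult: "a \<in> carrier M \<Longrightarrow> b \<in> carrier M \<Longrightarrow> lmon a m \<otimes>\<^bsub>L\<^esub> lmon b n = lmon (a \<otimes>\<^bsub>M\<^esub> b) (m + n)"
  by (rule cring.laurent_monom_monom[OF M_cring])

lemma lmon_add: "a \<in> carrier M \<Longrightarrow> b \<in> carrier M \<Longrightarrow> lmon (a \<oplus>\<^bsub>M\<^esub> b) n = lmon a n \<oplus>\<^bsub>L\<^esub> lmon b n"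
  by (rule cring.laurent_monom_add[OF M_cring])

lemma one_L: "\<one>\<^bsub>L\<^esub> = lmon \<one>\<^bsub>M\<^esub> 0"
  by (rule cring.laurent_simps(4)[OF M_cring])

lemma zero_mon: "lmon \<zero>\<^bsub>M\<^esub> n = \<zero>\<^bsub>L\<^esub>"
  by (rule cring.laurent_monom_zero[OF M_cring])

lemma const_hom: "(\<lambda>c. lmon (base_map M c) 0) \<in> ring_hom R L"
  using base_map_hom
  by (intro ring_hom_memI)
    (simp_all add: lmon_closed ring_hom_mult ring_hom_add ring_hom_one lmon_mult lmon_add one_L)

lemma const_UP_univ: "UP_univ_prop R L (\<lambda>c. lmon (base_map M c) 0) (lmon \<one>\<^bsub>M\<^esub> 2)"
  by (simp add: UP_univ_prop_def UP_pre_univ_prop_def UP_univ_prop_axioms_def lmon_closed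
      ring_hom_cringI[OF R_cring M_laurent_cring const_hom] UP_cring_def R_cring)

lemma ev_t_hom: "ev_t \<in> ring_hom (UP R) L"
proof -
  interpret E: UP_univ_prop R L "\<lambda>c. lmon (base_map M c) 0" "UP R" "lmon \<one>\<^bsub>M\<^esub> 2" ev_t
    by (simp_all add: const_UP_univ)
  show ?thesis by (rule E.homh)
qed

lemma ev_t_monom:
  "c \<in> carrier R \<Longrightarrow> ev_t (monom (UP R) c n) = lmon (base_map M c) 0 \<otimes>\<^bsub>L\<^esub> lmon \<one>\<^bsub>M\<^esub> 2 [^]\<^bsub>L\<^esub> n"
proof -
  interpret E: UP_univ_prop R L "\<lambda>c. lmon (base_map M c) 0" "UP R" "lmon \<one>\<^bsub>M\<^esub> 2" ev_t
    by (simp_all add: const_UP_univ)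
  show "c \<in> carrier R \<Longrightarrow> ?thesis" by (rule E.Eval_monom)
qed

lemma ev_t_const: "c \<in> carrier R \<Longrightarrow> ev_t (monom (UP R) c 0) = lmon (base_map M c) 0"
  by (simp add: ev_t_monom lmon_mult one_L flip: one_L) (simp add: one_L lmon_mult)

lemma ev_t_var: "ev_t (monom (UP R) \<one> 1) = lmon \<one>\<^bsub>M\<^esub> 2"
proof -
  interpret L: cring L by (rule M_laurent_cring)
  have "ev_t (monom (UP R) \<one> 1) = lmon \<one>\<^bsub>M\<^esub> 0 \<otimes>\<^bsub>L\<^esub> lmon \<one>\<^bsub>M\<^esub> 2 [^]\<^bsub>L\<^esub> (1::nat)"
    by (simp only: ev_t_monom[OF R.one_closed] ring_hom_one[OF base_map_hom])
  also have "\<dots> = lmon \<one>\<^bsub>M\<^esub> 2"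
    by (simp only: L.nat_pow_eone L.l_one lmon_closed one_closed flip: one_L)
  finally show ?thesis .
qed

lemma LA_simps: "carrier LA = carrier L" "mult LA = mult L" "one LA = one L" "zero LA = zero L" "add LA = add L"
  "smult LA p f = ev_t p \<otimes>\<^bsub>L\<^esub> f"
  by (simp_all add: laurent_alg_def)

lemma LA_cring: "cring LA"
  unfolding laurent_alg_def by (rule alg_via_cring[OF M_laurent_cring])

lemma LA_a_inv: "a_inv LA = a_inv L"
  by (simp add: laurent_alg_def)

text \<open>A polynomial \<open>p\<close> acts as multiplication by \<open>ev_t p\<close>, an
  expression in constants and (\<surd>t)^2, so a subring containing these is stable under the
  action.\<close>

lemma is_subalgI:
  assumes "subring S LA" "\<And>c. c \<in> carrier R \<Longrightarrow> lmon (base_map M c) 0 \<in> S" "lmon \<one>\<^bsub>M\<^esub> 2 \<in> S"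
  shows "is_subalg (UP R) LA S"
proof -
  interpret L: cring L by (rule M_laurent_cring)
  interpret P: UP_cring R "UP R" by (simp_all add: UP_cring_def R_cring)
  note S = subringE[OF assms(1), unfolded LA_simps]
  have "ev_t p \<in> S" if "p \<in> carrier (UP R)" for p
    using that
  proof (induction rule: P.UP_induct)
    case zero
    have "ev_t \<zero>\<^bsub>UP R\<^esub> = \<zero>\<^bsub>L\<^esub>"
      by (rule ring_hom_zero[OF ev_t_hom P.P.ring_axioms L.ring_axioms])
    then show ?case using S(2) by (simp only:)
  next
    case (add c n p)
    have "lmon \<one>\<^bsub>M\<^esub> 2 [^]\<^bsub>L\<^esub> n \<in> S"
      using S(3,6) assms(3) by (induction n) (auto simp: L.nat_pow_Suc)
    then have "ev_t (monom (UP R) c n) \<in> S"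
      unfolding ev_t_monom[OF add(1)] using S(6) assms(2) add(1) by blast
    moreover have "ev_t (monom (UP R) c n \<oplus>\<^bsub>UP R\<^esub> p) = ev_t (monom (UP R) c n) \<oplus>\<^bsub>L\<^esub> ev_t p"
      using add by (intro ring_hom_add[OF ev_t_hom]) simp_all
    ultimately show ?case using S(7) add.IH by (simp only:)
  qed
  then show ?thesis using S(6) assms(1) by (simp add: is_subalg_def LA_simps)
qed

text \<open>The converse of \<open>is_subalgI\<close>: letting a polynomial act on the unit element
  gives \<open>ev_t p\<close> itself.\<close>

lemma is_subalg_gens:
  assumes "is_subalg (UP R) LA S"
  shows "c \<in> carrier R \<Longrightarrow> lmon (base_map M c) 0 \<in> S" "lmon \<one>\<^bsub>M\<^esub> 2 \<in> S"
proof -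
  interpret L: cring L by (rule M_laurent_cring)
  interpret P: UP_cring R "UP R" by (simp_all add: UP_cring_def R_cring)
  have S: "subring S LA" "\<And>p f. p \<in> carrier (UP R) \<Longrightarrow> f \<in> S \<Longrightarrow> ev_t p \<otimes>\<^bsub>L\<^esub> f \<in> S"
    using assms by (auto simp: is_subalg_def LA_simps)
  have 1: "\<one>\<^bsub>L\<^esub> \<in> S" using subringE(3)[OF S(1)] by (simp only: LA_simps)
  have "ev_t p \<in> S" if "p \<in> carrier (UP R)" for p
    using S(2)[OF that 1] ring_hom_closed[OF ev_t_hom that] by (simp only: L.r_one)
  from this[of "monom (UP R) c 0"] this[of "monom (UP R) \<one> 1"]
  show "c \<in> carrier R \<Longrightarrow> lmon (base_map M c) 0 \<in> S" "lmon \<one>\<^bsub>M\<^esub> 2 \<in> S"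
    by (simp_all only: ev_t_const ev_t_var P.monom_closed R.one_closed)
qed

lemma C_carrier: "carrier C = generated_subalg (UP R) LA gens"
  by (simp add: contraction_alg_def)

lemma gens_closed: "gens \<subseteq> carrier L"
  by (auto simp: fixed_set_def anti_fixed_set_def lmon_closed)

lemma C_is_subalg: "is_subalg (UP R) LA (carrier C)"
proof -
  interpret LA: cring LA by (rule LA_cring)
  have "is_subalg (UP R) LA (carrier LA)"
    by (intro is_subalgI LA.carrier_is_subring) (simp_all add: LA_simps lmon_closed)
  \<comment> \<open>An intersection over no sets would be the whole type; the Laurent ring is a
    member of this family.\<close>
  then have ne: "{S. is_subalg (UP R) LA S \<and> gens \<subseteq> S} \<noteq> {}" using gens_closed by (auto simp: LA_simps)
  have "subring (\<Inter>{S. is_subalg (UP R) LA S \<and> gens \<subseteq> S}) LA"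
    by (rule LA.subring_Inter[OF _ ne]) (simp add: is_subalg_def)
  then show ?thesis
    unfolding C_carrier generated_subalg_def by (auto simp: is_subalg_def)
qed

lemma C_subring: "subring (carrier C) LA"
  using C_is_subalg by (simp add: is_subalg_def)

lemma C_simps: "mult C = mult L" "one C = one L" "zero C = zero L" "add C = add L"
  "smult C p f = ev_t p \<otimes>\<^bsub>L\<^esub> f"
  by (simp_all add: contraction_alg_def LA_simps)

lemma C_subset: "f \<in> carrier C \<Longrightarrow> f \<in> carrier L"
  using subringE(1)[OF C_subring] by (auto simp: LA_simps)

lemma gens_C: "gens \<subseteq> carrier C"
  unfolding C_carrier generated_subalg_def by blast

lemma lmon_C:
  "a \<in> fixed_set M \<theta> \<Longrightarrow> lmon a 0 \<in> carrier C" "a \<in> anti_fixed_set M \<theta> \<Longrightarrow> lmon a (-1) \<in> carrier C"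
  "lmon \<one>\<^bsub>M\<^esub> 2 \<in> carrier C"
  using gens_C is_subalg_gens[OF C_is_subalg] by blast+

lemma C_cring: "cring C"
proof -
  have "cring (LA\<lparr>carrier := carrier C\<rparr>)"
    using cring.subcringI'[OF LA_cring C_subring]
      ring.subcring_iff[OF cring.axioms(1)[OF LA_cring] subringE(1)[OF C_subring]] by simp
  moreover have "LA\<lparr>carrier := carrier C\<rparr> = C" by (simp add: contraction_alg_def)
  ultimately show ?thesis by simp
qed

lemma base_fixed: "c \<in> carrier R \<Longrightarrow> base_map M c \<in> fixed_set M \<theta>"
  by (simp add: fixed_set_def \<theta>_base_map)

text \<open>An induction principle for the contraction algebra. Constants from \<open>k\<close> are
  fixed by \<theta> and so already lie among the generators; only (\<surd>t)^2 has to be checked in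
  addition.\<close>

lemma C_minimal:
  assumes "subring S LA" "gens \<subseteq> S" "lmon \<one>\<^bsub>M\<^esub> 2 \<in> S"
  shows "carrier C \<subseteq> S"
proof -
  have "is_subalg (UP R) LA S"
    using assms base_fixed by (intro is_subalgI) blast+
  then show ?thesis using assms(2) unfolding C_carrier generated_subalg_def by blast
qed

lemma base_anti: "c \<in> carrier R \<Longrightarrow> b \<in> anti_fixed_set M \<theta> \<Longrightarrow> b \<otimes>\<^bsub>M\<^esub> base_map M c \<in> anti_fixed_set M \<theta>"
  by (simp add: anti_fixed_set_def \<theta>_base_map l_minus)

lemma \<Phi>_gens:
  "a \<in> fixed_set M \<theta> \<Longrightarrow> \<Phi> (lmon a 0) \<in> fixed_set Q \<sigma>"
  "b \<in> anti_fixed_set M \<theta> \<Longrightarrow> \<Phi> (lmon b (-1)) \<in> fixed_set Q \<sigma>"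
  "\<Phi> (lmon \<one>\<^bsub>M\<^esub> 2) \<in> fixed_set Q \<sigma>"
proof -
  have z: "\<zero>\<^bsub>M\<^esub> \<in> anti_fixed_set M \<theta>" "\<zero>\<^bsub>M\<^esub> \<in> fixed_set M \<theta>"
    by (simp_all add: anti_fixed_set_def fixed_set_def)
  show "a \<in> fixed_set M \<theta> \<Longrightarrow> \<Phi> (lmon a 0) \<in> fixed_set Q \<sigma>"
    using \<Phi>_monom(1)[of a] z fixed_set_pair_iff[of a "\<zero>\<^bsub>M\<^esub>"] by (simp add: fixed_set_def[of M])
  \<comment> \<open>The coefficient of x is b / t, still anti-fixed because \<open>t_inv\<close>
    comes from \<open>k\<close>.\<close>
  show "b \<in> anti_fixed_set M \<theta> \<Longrightarrow> \<Phi> (lmon b (-1)) \<in> fixed_set Q \<sigma>"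
    using \<Phi>_monom(3)[of b] base_anti[of "inv t" b] z t_unit
    by (simp add: fixed_set_pair_iff anti_fixed_set_def t_inv_def)
  show "\<Phi> (lmon \<one>\<^bsub>M\<^esub> 2) \<in> fixed_set Q \<sigma>"
    using \<Phi>_monom(2)[of "\<one>\<^bsub>M\<^esub>"] z base_fixed[of t] by (simp add: fixed_set_pair_iff)
qed

text \<open>The preimage of the fixed ring under \<Phi> is a subring containing the generators and
  the variable.\<close>

lemma \<Phi>_fixed: "f \<in> carrier C \<Longrightarrow> \<Phi> f \<in> fixed_set Q \<sigma>"
proof -
  interpret LA: cring LA by (rule LA_cring)
  interpret \<Phi>: ring_hom_cring L Q \<Phi>
    by (intro ring_hom_cringI M_laurent_cring quad_pair_cring \<Phi>_hom)
  note F = subringE[OF fixed_pair_subring]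
  let ?S = "{f \<in> carrier L. \<Phi> f \<in> fixed_set Q \<sigma>}"
  have "subring ?S LA"
    by (rule LA.subringI)
      (simp_all only: LA_simps LA_a_inv mem_Collect_eq \<Phi>.hom_one \<Phi>.hom_mult \<Phi>.hom_add \<Phi>.hom_a_inv F(3,5-7)
        \<Phi>.R.a_closed \<Phi>.R.m_closed \<Phi>.R.one_closed \<Phi>.R.a_inv_closed simp_thms, blast)
  moreover have "gens \<subseteq> ?S" "lmon \<one>\<^bsub>M\<^esub> 2 \<in> ?S"
    using gens_closed \<Phi>_gens by (auto simp: lmon_closed)
  ultimately show "f \<in> carrier C \<Longrightarrow> \<Phi> f \<in> fixed_set Q \<sigma>" using C_minimal by blast
qed

lemma \<Phi>_C_hom: "\<Phi> \<in> ring_hom C Qfix"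
  using \<Phi>_hom \<Phi>_fixed C_subset by (simp add: ring_hom_def C_simps fixed_pair_simps)

section \<open>The quotient of the contraction algebra at the scalar \<open>t\<close>\<close>

abbreviation "I \<equiv> contraction_ideal R M \<theta> t"
abbreviation "gen \<equiv> lmon \<one>\<^bsub>M\<^esub> 2 \<ominus>\<^bsub>C\<^esub> lmon \<tau> 0"
abbreviation "\<pi> \<equiv> \<lambda>f. I +>\<^bsub>C\<^esub> f"

lemma base_map_C: "p \<in> carrier (UP R) \<Longrightarrow> base_map C p = ev_t p"
proof -
  interpret L: cring L by (rule M_laurent_cring)
  show "p \<in> carrier (UP R) \<Longrightarrow> base_map C p = ev_t p"
    using ring_hom_closed[OF ev_t_hom] by (simp add: base_map_def C_simps)
qed

lemma lmon_base_C: "c \<in> carrier R \<Longrightarrow> lmon (base_map M c) 0 \<in> carrier C"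
  by (intro lmon_C base_fixed)

lemma gen_closed: "gen \<in> carrier C"
proof -
  interpret C: cring C by (rule C_cring)
  show ?thesis by (intro C.minus_closed lmon_C lmon_base_C t_closed)
qed

text \<open>Cofactors range over the contraction algebra and not over all Laurent polynomials, so a
  congruence requires a cofactor found inside it.\<close>

lemma contraction_ideal_eq: "I = {f \<otimes>\<^bsub>C\<^esub> gen | f. f \<in> carrier C}"
proof -
  interpret P: UP_cring R "UP R" by (simp_all add: UP_cring_def R_cring)
  have "base_map C (monom (UP R) \<one> 1) = lmon \<one>\<^bsub>M\<^esub> 2" "base_map C (monom (UP R) t 0) = lmon \<tau> 0"
    using P.monom_closed[of \<one> 1] P.monom_closed[of t 0] by (simp_all add: base_map_C ev_t_const ev_t_var del: One_nat_def)
  then show ?thesis by (simp add: contraction_ideal_def cgenideal_def)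
qed

lemma I_ideal: "ideal I C"
proof -
  interpret C: cring C by (rule C_cring)
  have "I = PIdl\<^bsub>C\<^esub> gen" by (simp add: contraction_ideal_eq cgenideal_def)
  then show ?thesis using C.cgenideal_ideal[OF gen_closed] by simp
qed

abbreviation "CQ \<equiv> C Quot I"

lemma CQ_cring: "cring CQ"
  by (rule ideal.quotient_is_cring[OF I_ideal C_cring])

lemma \<pi>_hom: "\<pi> \<in> ring_hom C CQ"
  by (rule ideal.rcos_ring_hom[OF I_ideal])

lemma \<pi>_eq_iff: "f \<in> carrier C \<Longrightarrow> g \<in> carrier C \<Longrightarrow> \<pi> f = \<pi> g \<longleftrightarrow> f \<ominus>\<^bsub>C\<^esub> g \<in> I"
  using ring.quotient_eq_iff_same_a_r_cos[OF cring.axioms(1)[OF C_cring] I_ideal] by blast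

lemma \<pi>_t: "\<pi> (lmon \<one>\<^bsub>M\<^esub> 2) = \<pi> (lmon \<tau> 0)"
proof -
  interpret C: cring C by (rule C_cring)
  have "gen = \<one>\<^bsub>C\<^esub> \<otimes>\<^bsub>C\<^esub> gen" using gen_closed by (rule C.l_one[symmetric])
  then have "gen \<in> I" unfolding contraction_ideal_eq using C.one_closed by blast
  then show ?thesis by (subst \<pi>_eq_iff) (simp_all only: lmon_C lmon_base_C t_closed)
qed

lemma fixed_closed: "a \<in> fixed_set M \<theta> \<Longrightarrow> a \<in> carrier M" "a \<in> anti_fixed_set M \<theta> \<Longrightarrow> a \<in> carrier M"
  by (simp_all add: fixed_set_def anti_fixed_set_def)

text \<open>
  The difference of the two elements is a multiple of the generator \<open>t - t\<^sub>0\<close> by \<open>b d / t\<close>,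
  which belongs to the contraction algebra as the product of \<open>b / \<surd>t\<close> and \<open>d / \<surd>t\<close>.
\<close>

lemma \<pi>_shift:
  assumes "b \<in> anti_fixed_set M \<theta>" "d \<in> anti_fixed_set M \<theta>"
  shows "\<pi> (lmon (\<tau> \<otimes>\<^bsub>M\<^esub> (b \<otimes>\<^bsub>M\<^esub> d)) (-2)) = \<pi> (lmon (b \<otimes>\<^bsub>M\<^esub> d) 0)"
proof -
  note bd = fixed_closed(2)[OF assms(1)] fixed_closed(2)[OF assms(2)]
  have f: "lmon (b \<otimes>\<^bsub>M\<^esub> d) (-2) \<in> carrier C"
    using cring.cring_simprules(5)[OF C_cring lmon_C(2)[OF assms(1)] lmon_C(2)[OF assms(2)]] bd
    by (simp add: C_simps lmon_mult)
  have "\<pi> (lmon (\<tau> \<otimes>\<^bsub>M\<^esub> (b \<otimes>\<^bsub>M\<^esub> d)) (-2)) = \<pi> (lmon \<tau> 0 \<otimes>\<^bsub>C\<^esub> lmon (b \<otimes>\<^bsub>M\<^esub> d) (-2))"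
    using bd by (simp add: C_simps lmon_mult)
  also have "\<dots> = \<pi> (lmon \<tau> 0) \<otimes>\<^bsub>CQ\<^esub> \<pi> (lmon (b \<otimes>\<^bsub>M\<^esub> d) (-2))"
    by (rule ring_hom_mult[OF \<pi>_hom lmon_base_C[OF t_closed] f])
  also have "\<dots> = \<pi> (lmon \<one>\<^bsub>M\<^esub> 2 \<otimes>\<^bsub>C\<^esub> lmon (b \<otimes>\<^bsub>M\<^esub> d) (-2))"
    unfolding \<pi>_t[symmetric] by (rule ring_hom_mult[OF \<pi>_hom lmon_C(3) f, symmetric])
  also have "\<dots> = \<pi> (lmon (b \<otimes>\<^bsub>M\<^esub> d) 0)"
    using bd by (simp add: C_simps lmon_mult)
  finally show ?thesis .
qed

text \<open>\<Phi> sends 1/\<surd>t to x / t with the scalar \<open>t\<close>; the factor \<tau>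
  compensates for this. Multiplicativity fails before passing to the quotient because two terms of
  exponent -1 multiply to one of exponent -2.\<close>

definition "\<rho> = (\<lambda>(a, b). lmon a 0 \<oplus>\<^bsub>L\<^esub> lmon (\<tau> \<otimes>\<^bsub>M\<^esub> b) (-1))"

lemma \<tau>_anti: "b \<in> anti_fixed_set M \<theta> \<Longrightarrow> \<tau> \<otimes>\<^bsub>M\<^esub> b \<in> anti_fixed_set M \<theta>"
  using base_anti[of t b] fixed_closed(2)[of b] by (simp add: m_comm)

lemma \<rho>_C:
  assumes "u \<in> fixed_set Q \<sigma>"
  shows "\<rho> u \<in> carrier C"
proof -
  obtain a b where u: "u = (a, b)" by (cases u)
  have ab: "a \<in> fixed_set M \<theta>" "b \<in> anti_fixed_set M \<theta>" using assms unfolding u fixed_set_pair_iff by auto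
  have "lmon a 0 \<oplus>\<^bsub>C\<^esub> lmon (\<tau> \<otimes>\<^bsub>M\<^esub> b) (-1) \<in> carrier C"
    by (intro cring.cring_simprules(1)[OF C_cring] lmon_C ab \<tau>_anti)
  then show ?thesis by (simp add: u \<rho>_def C_simps)
qed

lemma fixed_mult: "a \<in> fixed_set M \<theta> \<Longrightarrow> b \<in> fixed_set M \<theta> \<Longrightarrow> a \<otimes>\<^bsub>M\<^esub> b \<in> fixed_set M \<theta>"
  "a \<in> anti_fixed_set M \<theta> \<Longrightarrow> b \<in> anti_fixed_set M \<theta> \<Longrightarrow> a \<otimes>\<^bsub>M\<^esub> b \<in> fixed_set M \<theta>"
  by (simp_all add: fixed_set_def anti_fixed_set_def l_minus r_minus)

lemma \<rho>_add:
  assumes "u \<in> carrier Q" "v \<in> carrier Q"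
  shows "\<rho> (u \<oplus>\<^bsub>Q\<^esub> v) = \<rho> u \<oplus>\<^bsub>C\<^esub> \<rho> v"
proof -
  interpret L: cring L by (rule M_laurent_cring)
  from assms obtain a b c d where uv: "u = (a, b)" "v = (c, d)"
    and abcd: "a \<in> carrier M" "b \<in> carrier M" "c \<in> carrier M" "d \<in> carrier M" by auto
  show ?thesis using abcd
    by (simp add: uv \<rho>_def C_simps lmon_add lmon_closed r_distr L.a_ac)
qed

text \<open>The product of \<rho> u and \<rho> v has terms of exponents 0, -1 and -2, while \<rho>
  (u v) uses only 0 and -1. Modulo the ideal, \<open>\<pi>_shift\<close> moves the coefficient
  \<tau>^2 b d from -2 to \<tau> b d at 0.\<close>

lemma \<pi>_\<rho>_mult:
  assumes "u \<in> fixed_set Q \<sigma>" "v \<in> fixed_set Q \<sigma>"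
  shows "\<pi> (\<rho> (u \<otimes>\<^bsub>Q\<^esub> v)) = \<pi> (\<rho> u) \<otimes>\<^bsub>CQ\<^esub> \<pi> (\<rho> v)"
proof -
  interpret L: cring L by (rule M_laurent_cring)
  interpret C: cring C by (rule C_cring)
  obtain a b where u: "u = (a, b)" by (cases u)
  obtain c d where v: "v = (c, d)" by (cases v)
  have ab: "a \<in> fixed_set M \<theta>" "b \<in> anti_fixed_set M \<theta>" using assms(1) unfolding u fixed_set_pair_iff by auto
  have cd: "c \<in> fixed_set M \<theta>" "d \<in> anti_fixed_set M \<theta>" using assms(2) unfolding v fixed_set_pair_iff by auto
  note cl = fixed_closed(1)[OF ab(1)] fixed_closed(2)[OF ab(2)] fixed_closed(1)[OF cd(1)] fixed_closed(2)[OF cd(2)]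
  let ?x = "\<tau> \<otimes>\<^bsub>M\<^esub> (a \<otimes>\<^bsub>M\<^esub> d \<oplus>\<^bsub>M\<^esub> b \<otimes>\<^bsub>M\<^esub> c)"
  \<comment> \<open>Grouped so that \<open>\<pi>_shift\<close> applies to the anti-fixed elements
    \<tau> b and d; the shift consumes the other factor \<tau>.\<close>
  let ?y = "(\<tau> \<otimes>\<^bsub>M\<^esub> b) \<otimes>\<^bsub>M\<^esub> d"
  have uv_fixed: "u \<otimes>\<^bsub>Q\<^esub> v \<in> fixed_set Q \<sigma>" using subringE(6)[OF fixed_pair_subring] assms by blast
  have x: "lmon ?x (-1) \<in> carrier C"
    using uv_fixed unfolding u v quad_pair_simps fixed_set_pair_iff by (blast intro: lmon_C \<tau>_anti)
  have ac: "lmon (a \<otimes>\<^bsub>M\<^esub> c) 0 \<in> carrier C" by (intro lmon_C fixed_mult ab cd)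
  have y0: "lmon ?y 0 \<in> carrier C" by (intro lmon_C fixed_mult \<tau>_anti ab cd)
  \<comment> \<open>Exponent -2 is reached inside the contraction algebra as a product of two
    generators.\<close>
  have y2: "lmon (\<tau> \<otimes>\<^bsub>M\<^esub> ?y) (-2) \<in> carrier C"
  proof -
    have "lmon (\<tau> \<otimes>\<^bsub>M\<^esub> b) (-1) \<otimes>\<^bsub>C\<^esub> lmon (\<tau> \<otimes>\<^bsub>M\<^esub> d) (-1) \<in> carrier C"
      by (intro C.m_closed lmon_C \<tau>_anti ab cd)
    then show ?thesis using cl by (simp add: C_simps lmon_mult m_ac)
  qed
  have "\<rho> u \<otimes>\<^bsub>C\<^esub> \<rho> v = (lmon (a \<otimes>\<^bsub>M\<^esub> c) 0 \<oplus>\<^bsub>C\<^esub> lmon ?x (-1)) \<oplus>\<^bsub>C\<^esub> lmon (\<tau> \<otimes>\<^bsub>M\<^esub> ?y) (-2)"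
    using cl
    by (simp add: u v \<rho>_def C_simps L.l_distr L.r_distr lmon_mult lmon_add lmon_closed r_distr)
      (simp add: L.a_ac lmon_closed m_ac)
  then have "\<pi> (\<rho> u \<otimes>\<^bsub>C\<^esub> \<rho> v) =
      \<pi> (lmon (a \<otimes>\<^bsub>M\<^esub> c) 0 \<oplus>\<^bsub>C\<^esub> lmon ?x (-1)) \<oplus>\<^bsub>CQ\<^esub> \<pi> (lmon (\<tau> \<otimes>\<^bsub>M\<^esub> ?y) (-2))"
    using ring_hom_add[OF \<pi>_hom C.a_closed[OF ac x] y2] by (simp only:)
  also have "\<dots> = \<pi> ((lmon (a \<otimes>\<^bsub>M\<^esub> c) 0 \<oplus>\<^bsub>C\<^esub> lmon ?x (-1)) \<oplus>\<^bsub>C\<^esub> lmon ?y 0)"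
    using ring_hom_add[OF \<pi>_hom C.a_closed[OF ac x] y0] \<pi>_shift[OF \<tau>_anti[OF ab(2)] cd(2)] by (simp only:)
  also have "(lmon (a \<otimes>\<^bsub>M\<^esub> c) 0 \<oplus>\<^bsub>C\<^esub> lmon ?x (-1)) \<oplus>\<^bsub>C\<^esub> lmon ?y 0 = \<rho> (u \<otimes>\<^bsub>Q\<^esub> v)"
    using cl by (simp add: u v \<rho>_def C_simps lmon_add lmon_closed m_assoc L.a_ac)
  also have "\<pi> (\<rho> u \<otimes>\<^bsub>C\<^esub> \<rho> v) = \<pi> (\<rho> u) \<otimes>\<^bsub>CQ\<^esub> \<pi> (\<rho> v)"
    by (rule ring_hom_mult[OF \<pi>_hom \<rho>_C[OF assms(1)] \<rho>_C[OF assms(2)]])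
  finally show ?thesis by simp
qed

lemma \<rho>_one: "\<rho> \<one>\<^bsub>Q\<^esub> = \<one>\<^bsub>C\<^esub>"
proof -
  interpret L: cring L by (rule M_laurent_cring)
  show ?thesis by (simp add: \<rho>_def C_simps zero_mon flip: one_L)
qed

lemma \<pi>_\<rho>_hom: "(\<lambda>u. \<pi> (\<rho> u)) \<in> ring_hom Qfix CQ"
proof (rule ring_hom_memI)
  have car: "u \<in> carrier Q" if "u \<in> fixed_set Q \<sigma>" for u using that by (simp add: fixed_set_def)
  show "\<pi> (\<rho> u) \<in> carrier CQ" if "u \<in> carrier Qfix" for u
    using that by (intro ring_hom_closed[OF \<pi>_hom] \<rho>_C) (simp add: fixed_pair_simps)
  show "\<pi> (\<rho> (u \<otimes>\<^bsub>Qfix\<^esub> v)) = \<pi> (\<rho> u) \<otimes>\<^bsub>CQ\<^esub> \<pi> (\<rho> v)" if "u \<in> carrier Qfix" "v \<in> carrier Qfix" for u v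
    using that \<pi>_\<rho>_mult by (simp only: fixed_pair_simps)
  show "\<pi> (\<rho> (u \<oplus>\<^bsub>Qfix\<^esub> v)) = \<pi> (\<rho> u) \<oplus>\<^bsub>CQ\<^esub> \<pi> (\<rho> v)" if "u \<in> carrier Qfix" "v \<in> carrier Qfix" for u v
    using that ring_hom_add[OF \<pi>_hom \<rho>_C \<rho>_C] \<rho>_add[OF car car] by (simp only: fixed_pair_simps)
  show "\<pi> (\<rho> \<one>\<^bsub>Qfix\<^esub>) = \<one>\<^bsub>CQ\<^esub>"
    unfolding fixed_pair_simps \<rho>_one by (rule ring_hom_one[OF \<pi>_hom])
qed

lemma t_inv_t: "b \<in> carrier M \<Longrightarrow> \<tau> \<otimes>\<^bsub>M\<^esub> (b \<otimes>\<^bsub>M\<^esub> t_inv) = b"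
  using t_t_inv by (metis base_map_closed l_one m_assoc m_comm t_closed t_inv_closed)

text \<open>The equalizer below is a subring of \<open>C\<close>, while \<open>C_minimal\<close>
  speaks of \<open>LA\<close>. The operations agree, but additive inverses are defined relative to
  the carrier and have to be compared.\<close>

lemma C_subring_imp_LA:
  assumes "subring S C"
  shows "subring S LA"
proof -
  interpret LA: cring LA by (rule LA_cring)
  interpret C: cring C by (rule C_cring)
  note S = subringE[OF assms]
  have SL: "h \<in> carrier LA" if "h \<in> S" for h using that S(1) C_subset by (auto simp: LA_simps)
  have "\<ominus>\<^bsub>LA\<^esub> h = \<ominus>\<^bsub>C\<^esub> h" if h: "h \<in> S" for h
  proof (rule LA.minus_equality)
    have "h \<in> carrier C" using S(1) h by blast
    from C.l_neg[OF this] show "\<ominus>\<^bsub>C\<^esub> h \<oplus>\<^bsub>LA\<^esub> h = \<zero>\<^bsub>LA\<^esub>" by (simp only: C_simps LA_simps)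
  qed (use h S(5) SL in blast)+
  then show ?thesis
    using S SL by (intro LA.subringI) (auto simp: C_simps LA_simps)
qed

lemma \<pi>_\<rho>_\<Phi>: "f \<in> carrier C \<Longrightarrow> \<pi> (\<rho> (\<Phi> f)) = \<pi> f"
proof -
  interpret L: cring L by (rule M_laurent_cring)
  let ?S = "{f \<in> carrier C. \<pi> (\<rho> (\<Phi> f)) = \<pi> f}"
  have "(\<lambda>u. \<pi> (\<rho> u)) \<circ> \<Phi> \<in> ring_hom C CQ"
    by (rule ring_hom_trans[OF \<Phi>_C_hom \<pi>_\<rho>_hom])
  then have "subring ?S C"
    using ring_hom_equalizer_subring[OF C_cring CQ_cring _ \<pi>_hom] by (simp add: comp_def)
  then have "subring ?S LA"
    by (rule C_subring_imp_LA)
  moreover have "gens \<subseteq> ?S"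
  proof -
    have "\<pi> (\<rho> (\<Phi> (lmon a 0))) = \<pi> (lmon a 0)" if "a \<in> fixed_set M \<theta>" for a
      using \<Phi>_monom(1)[OF fixed_closed(1)[OF that]] fixed_closed(1)[OF that]
      by (simp add: \<rho>_def zero_mon lmon_closed)
    moreover have "\<pi> (\<rho> (\<Phi> (lmon b (-1)))) = \<pi> (lmon b (-1))" if "b \<in> anti_fixed_set M \<theta>" for b
      using \<Phi>_monom(3)[OF fixed_closed(2)[OF that]] fixed_closed(2)[OF that]
      by (simp add: \<rho>_def zero_mon lmon_closed t_inv_t)
    ultimately show ?thesis using gens_C by blast
  qed
  \<comment> \<open>The variable evaluates to \<tau>, and \<rho> returns this constant; the two are
    identified only in the quotient, by \<open>\<pi>_t\<close>.\<close>
  moreover have "lmon \<one>\<^bsub>M\<^esub> 2 \<in> ?S"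
    using \<Phi>_monom(2)[OF one_closed] \<pi>_t lmon_C(3) by (simp add: \<rho>_def zero_mon lmon_closed)
  ultimately have "carrier C \<subseteq> ?S" by (rule C_minimal)
  then show "f \<in> carrier C \<Longrightarrow> \<pi> (\<rho> (\<Phi> f)) = \<pi> f" by blast
qed

lemma \<Phi>_\<rho>:
  assumes "u \<in> carrier Q"
  shows "\<Phi> (\<rho> u) = u"
proof -
  obtain a b where u: "u = (a, b)" "a \<in> carrier M" "b \<in> carrier M" using assms by auto
  have "\<tau> \<otimes>\<^bsub>M\<^esub> b \<otimes>\<^bsub>M\<^esub> t_inv = b" using t_inv_t[OF u(3)] u by (simp add: m_assoc)
  moreover have "\<Phi> (\<rho> u) = \<Phi> (lmon a 0) \<oplus>\<^bsub>Q\<^esub> \<Phi> (lmon (\<tau> \<otimes>\<^bsub>M\<^esub> b) (-1))"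
    unfolding u \<rho>_def prod.case using u by (intro ring_hom_add[OF \<Phi>_hom] lmon_closed) auto
  ultimately show ?thesis using u \<Phi>_monom(1)[of a] \<Phi>_monom(3)[of "\<tau> \<otimes>\<^bsub>M\<^esub> b"] by simp
qed

lemma \<Phi>_ring_hom_ring: "ring_hom_ring C Qfix \<Phi>"
  by (intro ring_hom_ringI2 cring.axioms(1) C_cring fixed_pair_cring \<Phi>_C_hom)

text \<open>If \<Phi> f = 0, then f is congruent to \<rho> 0 = 0 by
  \<open>\<pi>_\<rho>_\<Phi>\<close>; conversely \<Phi> sends the generator of the ideal to \<tau> -
  \<tau> = 0.\<close>

lemma kernel_\<Phi>: "a_kernel C Qfix \<Phi> = I"
proof -
  interpret C: cring C by (rule C_cring)
  interpret H: ring_hom_ring C Qfix \<Phi> by (rule \<Phi>_ring_hom_ring)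
  have zero: "\<rho> \<zero>\<^bsub>Q\<^esub> = \<zero>\<^bsub>C\<^esub>"
    using cring.cring_simprules(2,8)[OF M_laurent_cring] by (simp add: \<rho>_def zero_mon C_simps)
  have "f \<in> I" if "f \<in> carrier C" "\<Phi> f = \<zero>\<^bsub>Qfix\<^esub>" for f
  proof -
    have "\<pi> f = \<pi> \<zero>\<^bsub>C\<^esub>" using \<pi>_\<rho>_\<Phi>[OF that(1)] that(2) zero by (simp only: fixed_pair_simps)
    then have "f \<ominus>\<^bsub>C\<^esub> \<zero>\<^bsub>C\<^esub> \<in> I" using that(1) by (subst (asm) \<pi>_eq_iff) simp_all
    then show "f \<in> I" using that(1) by (simp add: a_minus_def)
  qed
  moreover have "f \<otimes>\<^bsub>C\<^esub> gen \<in> carrier C \<and> \<Phi> (f \<otimes>\<^bsub>C\<^esub> gen) = \<zero>\<^bsub>Qfix\<^esub>" if f: "f \<in> carrier C" for f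
  proof -
    have "\<Phi> (lmon \<one>\<^bsub>M\<^esub> 2) = \<Phi> (lmon \<tau> 0)"
      using \<Phi>_monom(2)[OF one_closed] \<Phi>_monom(1)[of \<tau>] by simp
    moreover have "\<Phi> gen = \<Phi> (lmon \<one>\<^bsub>M\<^esub> 2) \<ominus>\<^bsub>Qfix\<^esub> \<Phi> (lmon \<tau> 0)"
      unfolding a_minus_def using lmon_C(3) lmon_base_C[OF t_closed] by simp
    ultimately have "\<Phi> gen = \<zero>\<^bsub>Qfix\<^esub>"
      using H.hom_closed[OF lmon_base_C[OF t_closed]] by (simp add: a_minus_def H.S.r_neg)
    then show ?thesis using f gen_closed by simp
  qed
  ultimately show ?thesis unfolding a_kernel_def' contraction_ideal_eq by blast
qed

section \<open>The induced isomorphism onto the fixed ring\<close>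

abbreviation "CA \<equiv> contraction_at R M \<theta> t"
definition "\<phi> X = the_elem (\<Phi> ` X)"

lemma const_C_hom: "(\<lambda>c. base_map C (monom (UP R) c 0)) \<in> ring_hom R C"
proof -
  interpret P: UP_cring R "UP R" by (simp_all add: UP_cring_def R_cring)
  have eq: "base_map C (monom (UP R) c 0) = lmon (base_map M c) 0" if "c \<in> carrier R" for c
    using that by (simp add: base_map_C ev_t_const)
  show ?thesis
    using const_hom
    by (intro ring_hom_memI)
      (simp_all only: eq lmon_base_C ring_hom_mult[OF const_hom] ring_hom_add[OF const_hom]
        ring_hom_one[OF const_hom] C_simps R.m_closed R.a_closed R.one_closed)
qed

lemma CA_algebra: "algebra R CA"
proof -
  have "\<pi> \<circ> (\<lambda>c. base_map C (monom (UP R) c 0)) \<in> ring_hom R CQ"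
    by (rule ring_hom_trans[OF const_C_hom \<pi>_hom])
  then show ?thesis unfolding contraction_at_def
    by (intro alg_via_algebra R_cring CQ_cring) (simp add: comp_def)
qed

text \<open>Injectivity comes from the kernel; \<rho> provides a preimage in the contraction algebra
  for each fixed pair.\<close>

lemma \<phi>_ring_iso: "\<phi> \<in> ring_iso CQ Qfix"
proof -
  have "\<Phi> ` carrier C = carrier Qfix"
  proof
    show "carrier Qfix \<subseteq> \<Phi> ` carrier C"
    proof
      fix u assume "u \<in> carrier Qfix"
      then have u: "u \<in> fixed_set Q \<sigma>" "u \<in> carrier Q" by (simp_all add: fixed_pair_simps fixed_set_def)
      show "u \<in> \<Phi> ` carrier C" using \<Phi>_\<rho>[OF u(2)] \<rho>_C[OF u(1)] by (metis image_eqI)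
    qed
  qed (use \<Phi>_fixed in \<open>auto simp: fixed_pair_simps\<close>)
  from ring_hom_ring.FactRing_iso_set[OF \<Phi>_ring_hom_ring this]
  show ?thesis unfolding kernel_\<Phi> by (simp add: \<phi>_def[abs_def])
qed

lemma \<phi>_base: "c \<in> carrier R \<Longrightarrow> \<phi> (\<pi> (base_map C (monom (UP R) c 0))) = (base_map M c, \<zero>\<^bsub>M\<^esub>)"
proof -
  interpret P: UP_cring R "UP R" by (simp_all add: UP_cring_def R_cring)
  assume c: "c \<in> carrier R"
  have "\<phi> (\<pi> (lmon (base_map M c) 0)) = \<Phi> (lmon (base_map M c) 0)"
    unfolding \<phi>_def using ring_hom_ring.the_elem_simp[OF \<Phi>_ring_hom_ring lmon_base_C[OF c]] by (simp only: kernel_\<Phi>)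
  then show ?thesis using c \<Phi>_monom(1)[of "base_map M c"] by (simp add: base_map_C ev_t_const)
qed

lemma \<phi>_alg_iso: "\<phi> \<in> alg_iso R CA Qfix"
proof -
  have h: "\<phi> \<in> ring_hom CQ Qfix" using \<phi>_ring_iso by (simp add: ring_iso_def)
  have "\<phi> (c \<odot>\<^bsub>CA\<^esub> X) = c \<odot>\<^bsub>Qfix\<^esub> \<phi> X" if c: "c \<in> carrier R" and X: "X \<in> carrier CQ" for c X
  proof -
    have "\<pi> (base_map C (monom (UP R) c 0)) \<in> carrier CQ"
      by (intro ring_hom_closed[OF \<pi>_hom] ring_hom_closed[OF const_C_hom] c)
    then have "\<phi> (c \<odot>\<^bsub>CA\<^esub> X) = (base_map M c, \<zero>\<^bsub>M\<^esub>) \<otimes>\<^bsub>Q\<^esub> \<phi> X"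
      using ring_hom_mult[OF h _ X] \<phi>_base[OF c] by (simp add: contraction_at_def fixed_pair_simps)
    moreover have "\<phi> X \<in> carrier Q"
      using ring_hom_closed[OF h X] by (auto simp: fixed_pair_simps fixed_set_def)
    ultimately show ?thesis using c by (auto simp: fixed_pair_simps smult_eq_base_map)
  qed
  moreover have "\<phi> \<in> ring_hom CA Qfix" using h by (simp add: contraction_at_def ring_hom_def)
  ultimately show ?thesis using \<phi>_ring_iso by (simp add: alg_iso_def alg_hom_def ring_iso_def contraction_at_def)
qed

end

section \<open>Scalar extension and square roots\<close>

context quad_algebra
begin

text \<open>The universal property of adjoining a square root of \<open>t\<close>: x may go to any
  element whose square is the image of \<open>t\<close>. It is used with x going to a root in
  \<open>k\<close>, and with x going to x over \<phi>.\<close>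

lemma quad_pair_homI:
  assumes "cring S" "f \<in> ring_hom M S" "x \<in> carrier S" "x \<otimes>\<^bsub>S\<^esub> x = f (base_map M t)"
  shows "(\<lambda>(a, b). f a \<oplus>\<^bsub>S\<^esub> x \<otimes>\<^bsub>S\<^esub> f b) \<in> ring_hom Q S"
proof -
  interpret S: cring S by fact
  interpret f: ring_hom_cring M S f using assms M_cring by (intro ring_hom_cringI)
  have mult: "f (a \<otimes>\<^bsub>M\<^esub> c \<oplus>\<^bsub>M\<^esub> base_map M t \<otimes>\<^bsub>M\<^esub> (b \<otimes>\<^bsub>M\<^esub> d)) \<oplus>\<^bsub>S\<^esub> x \<otimes>\<^bsub>S\<^esub> f (a \<otimes>\<^bsub>M\<^esub> d \<oplus>\<^bsub>M\<^esub> b \<otimes>\<^bsub>M\<^esub> c) =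
      (f a \<oplus>\<^bsub>S\<^esub> x \<otimes>\<^bsub>S\<^esub> f b) \<otimes>\<^bsub>S\<^esub> (f c \<oplus>\<^bsub>S\<^esub> x \<otimes>\<^bsub>S\<^esub> f d)"
    if "a \<in> carrier M" "b \<in> carrier M" "c \<in> carrier M" "d \<in> carrier M" for a b c d
    using that assms(3) assms(4)[symmetric] by (simp add: S.l_distr S.r_distr S.m_ac S.a_ac)
  show ?thesis
    by (rule ring_hom_memI) (use assms(3) mult in \<open>auto simp: S.l_distr S.r_distr S.m_ac S.a_ac\<close>)
qed

end

context involutive_quad_algebra
begin

text \<open>The fixed part of \<open>u = a + s b\<close> is \<open>(u + \<theta> u) / 2\<close>, and \<open>b = (u - \<theta> u) / (2 s)\<close>.\<close>

lemma split_bij: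
  assumes two: "\<one> \<oplus> \<one> \<in> Units R" and s: "s \<in> Units R"
  shows "bij_betw (\<lambda>(a, b). a \<oplus>\<^bsub>M\<^esub> base_map M s \<otimes>\<^bsub>M\<^esub> b) (fixed_set Q \<sigma>) (carrier M)"
proof -
  interpret b: ring_hom_cring R M "base_map M" by (rule base_map_ring_hom_cring)
  let ?h = "base_map M (inv (\<one> \<oplus> \<one>))" and ?s = "base_map M s" and ?s' = "base_map M (inv s)"
  have c: "?h \<in> carrier M" "?s \<in> carrier M" "?s' \<in> carrier M" using two s R.Units_closed[OF s] by simp_all
  have h: "?h \<otimes>\<^bsub>M\<^esub> (a \<oplus>\<^bsub>M\<^esub> a) = a" if a: "a \<in> carrier M" for a
  proof -
    have "(\<one>\<^bsub>M\<^esub> \<oplus>\<^bsub>M\<^esub> \<one>\<^bsub>M\<^esub>) \<otimes>\<^bsub>M\<^esub> ?h = \<one>\<^bsub>M\<^esub>"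
      using two b.hom_mult[of "\<one> \<oplus> \<one>" "inv (\<one> \<oplus> \<one>)"] by simp
    then have "((\<one>\<^bsub>M\<^esub> \<oplus>\<^bsub>M\<^esub> \<one>\<^bsub>M\<^esub>) \<otimes>\<^bsub>M\<^esub> ?h) \<otimes>\<^bsub>M\<^esub> a = a" using a by simp
    then show ?thesis using a c by (simp add: l_distr r_distr)
  qed
  have ss: "?s \<otimes>\<^bsub>M\<^esub> (?s' \<otimes>\<^bsub>M\<^esub> a) = a" "?s' \<otimes>\<^bsub>M\<^esub> (?s \<otimes>\<^bsub>M\<^esub> a) = a" if a: "a \<in> carrier M" for a
  proof -
    have "?s \<otimes>\<^bsub>M\<^esub> ?s' = \<one>\<^bsub>M\<^esub>" "?s' \<otimes>\<^bsub>M\<^esub> ?s = \<one>\<^bsub>M\<^esub>"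
      using s R.Units_closed[OF s] b.hom_mult[of s "inv s"] b.hom_mult[of "inv s" s] by simp_all
    then show "?s \<otimes>\<^bsub>M\<^esub> (?s' \<otimes>\<^bsub>M\<^esub> a) = a" "?s' \<otimes>\<^bsub>M\<^esub> (?s \<otimes>\<^bsub>M\<^esub> a) = a"
      using a c by (simp_all flip: m_assoc)
  qed
  have \<theta>s: "\<theta> ?h = ?h" "\<theta> ?s = ?s" "\<theta> ?s' = ?s'" using two s R.Units_closed[OF s] by (simp_all add: \<theta>_base_map)
  have left: "?h \<otimes>\<^bsub>M\<^esub> (u \<oplus>\<^bsub>M\<^esub> \<theta> u) = a \<and> ?s' \<otimes>\<^bsub>M\<^esub> (?h \<otimes>\<^bsub>M\<^esub> (u \<ominus>\<^bsub>M\<^esub> \<theta> u)) = b"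
    if ab: "a \<in> fixed_set M \<theta>" "b \<in> anti_fixed_set M \<theta>" and u: "u = a \<oplus>\<^bsub>M\<^esub> ?s \<otimes>\<^bsub>M\<^esub> b" for a b u
  proof -
    have cl: "a \<in> carrier M" "b \<in> carrier M" "\<theta> a = a" "\<theta> b = \<ominus>\<^bsub>M\<^esub> b"
      using ab by (simp_all add: fixed_set_def anti_fixed_set_def)
    define v where "v = ?s \<otimes>\<^bsub>M\<^esub> b"
    have v: "v \<in> carrier M" "\<theta> v = \<ominus>\<^bsub>M\<^esub> v" using cl c by (simp_all add: v_def \<theta>s r_minus)
    have e1: "u \<oplus>\<^bsub>M\<^esub> \<theta> u = a \<oplus>\<^bsub>M\<^esub> a"
    proof -
      have "u \<oplus>\<^bsub>M\<^esub> \<theta> u = (a \<oplus>\<^bsub>M\<^esub> a) \<oplus>\<^bsub>M\<^esub> (v \<oplus>\<^bsub>M\<^esub> \<ominus>\<^bsub>M\<^esub> v)"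
        unfolding u v_def[symmetric] using cl v by (simp add: M.a_ac del: M.r_neg)
      then show ?thesis using cl v by (simp add: M.r_neg)
    qed
    have e2: "u \<ominus>\<^bsub>M\<^esub> \<theta> u = v \<oplus>\<^bsub>M\<^esub> v"
    proof -
      have "u \<ominus>\<^bsub>M\<^esub> \<theta> u = (v \<oplus>\<^bsub>M\<^esub> v) \<oplus>\<^bsub>M\<^esub> (a \<oplus>\<^bsub>M\<^esub> \<ominus>\<^bsub>M\<^esub> a)"
        unfolding u v_def[symmetric] using cl v by (simp add: a_minus_def M.minus_add M.a_ac del: M.r_neg)
      then show ?thesis using cl v by (simp add: M.r_neg)
    qed
    show ?thesis unfolding e1 e2 using cl v by (simp add: h ss v_def)
  qed
  have right: "?h \<otimes>\<^bsub>M\<^esub> (u \<oplus>\<^bsub>M\<^esub> \<theta> u) \<oplus>\<^bsub>M\<^esub> ?s \<otimes>\<^bsub>M\<^esub> (?s' \<otimes>\<^bsub>M\<^esub> (?h \<otimes>\<^bsub>M\<^esub> (u \<ominus>\<^bsub>M\<^esub> \<theta> u))) = u"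
    and rfix: "?h \<otimes>\<^bsub>M\<^esub> (u \<oplus>\<^bsub>M\<^esub> \<theta> u) \<in> fixed_set M \<theta>"
      "?s' \<otimes>\<^bsub>M\<^esub> (?h \<otimes>\<^bsub>M\<^esub> (u \<ominus>\<^bsub>M\<^esub> \<theta> u)) \<in> anti_fixed_set M \<theta>"
    if u: "u \<in> carrier M" for u
  proof -
    have "(u \<oplus>\<^bsub>M\<^esub> \<theta> u) \<oplus>\<^bsub>M\<^esub> (u \<ominus>\<^bsub>M\<^esub> \<theta> u) = (u \<oplus>\<^bsub>M\<^esub> u) \<oplus>\<^bsub>M\<^esub> (\<theta> u \<oplus>\<^bsub>M\<^esub> \<ominus>\<^bsub>M\<^esub> \<theta> u)"
      using u by (simp add: a_minus_def M.a_ac del: M.r_neg)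
    then have e: "(u \<oplus>\<^bsub>M\<^esub> \<theta> u) \<oplus>\<^bsub>M\<^esub> (u \<ominus>\<^bsub>M\<^esub> \<theta> u) = u \<oplus>\<^bsub>M\<^esub> u" using u by (simp add: M.r_neg)
    have "?h \<otimes>\<^bsub>M\<^esub> (u \<oplus>\<^bsub>M\<^esub> \<theta> u) \<oplus>\<^bsub>M\<^esub> ?h \<otimes>\<^bsub>M\<^esub> (u \<ominus>\<^bsub>M\<^esub> \<theta> u) = u"
      using u c h[OF u] by (simp flip: r_distr add: e)
    then show "?h \<otimes>\<^bsub>M\<^esub> (u \<oplus>\<^bsub>M\<^esub> \<theta> u) \<oplus>\<^bsub>M\<^esub> ?s \<otimes>\<^bsub>M\<^esub> (?s' \<otimes>\<^bsub>M\<^esub> (?h \<otimes>\<^bsub>M\<^esub> (u \<ominus>\<^bsub>M\<^esub> \<theta> u))) = u"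
      using u c by (simp add: ss)
    show "?h \<otimes>\<^bsub>M\<^esub> (u \<oplus>\<^bsub>M\<^esub> \<theta> u) \<in> fixed_set M \<theta>"
      using u c by (simp add: fixed_set_def \<theta>s \<theta>_\<theta> M.a_comm)
    have "\<theta> (u \<ominus>\<^bsub>M\<^esub> \<theta> u) = \<ominus>\<^bsub>M\<^esub> (u \<ominus>\<^bsub>M\<^esub> \<theta> u)"
      using u by (simp add: a_minus_def \<theta>_\<theta> M.minus_add M.a_comm)
    then show "?s' \<otimes>\<^bsub>M\<^esub> (?h \<otimes>\<^bsub>M\<^esub> (u \<ominus>\<^bsub>M\<^esub> \<theta> u)) \<in> anti_fixed_set M \<theta>"
      using u c by (simp add: anti_fixed_set_def \<theta>s r_minus)
  qed
  let ?f = "\<lambda>(a, b). a \<oplus>\<^bsub>M\<^esub> ?s \<otimes>\<^bsub>M\<^esub> b"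
  let ?g = "\<lambda>u. (?h \<otimes>\<^bsub>M\<^esub> (u \<oplus>\<^bsub>M\<^esub> \<theta> u), ?s' \<otimes>\<^bsub>M\<^esub> (?h \<otimes>\<^bsub>M\<^esub> (u \<ominus>\<^bsub>M\<^esub> \<theta> u)))"
  show ?thesis
  proof (rule bij_betw_byWitness[where f' = ?g])
    show "\<forall>x\<in>fixed_set Q \<sigma>. ?g (?f x) = x"
    proof
      fix x assume x: "x \<in> fixed_set Q \<sigma>"
      obtain a b where ab: "x = (a, b)" by (cases x)
      show "?g (?f x) = x"
        using left[OF _ _ refl, of a b] x unfolding ab fixed_set_pair_iff by auto
    qed
    show "\<forall>u\<in>carrier M. ?f (?g u) = u" using right by simp
    show "?f ` fixed_set Q \<sigma> \<subseteq> carrier M" using c by (auto simp: fixed_set_def)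
    show "?g ` carrier M \<subseteq> fixed_set Q \<sigma>" using rfix fixed_set_pair_iff by blast
  qed
qed

text \<open>Sending x to \<open>s\<close> turns a + b x into a + s b: a homomorphism by
  \<open>quad_pair_homI\<close>, and bijective on the fixed ring by
  \<open>split_bij\<close>.\<close>

lemma sqrt_alg_iso:
  assumes two: "\<one> \<oplus> \<one> \<in> Units R" and s: "s \<in> carrier R" "s \<otimes> s = t"
  shows "\<exists>h. h \<in> alg_iso R CA M"
proof -
  interpret b: ring_hom_cring R M "base_map M" by (rule base_map_ring_hom_cring)
  let ?f = "\<lambda>(a, b). a \<oplus>\<^bsub>M\<^esub> base_map M s \<otimes>\<^bsub>M\<^esub> b"
  \<comment> \<open>\<open>split_bij\<close> asks for a unit; s (s / t) = 1 exhibits the inverse of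
    \<open>s\<close>.\<close>
  have "s \<otimes> inv t \<in> carrier R" "s \<otimes> (s \<otimes> inv t) = \<one>"
    using s t_unit by (simp_all flip: R.m_assoc)
  then have su: "s \<in> Units R"
    using s(1) R.m_comm[of "s \<otimes> inv t" s] unfolding Units_def by auto
  have "(\<lambda>a. a) \<in> ring_hom M M" by (intro ring_hom_memI) auto
  from quad_pair_homI[OF M_cring this, of "base_map M s"]
  have f: "?f \<in> ring_hom Q M" using s b.hom_mult[of s s] by simp
  have "fixed_set Q \<sigma> \<subseteq> carrier Q" by (auto simp: fixed_set_def)
  then have "?f \<in> ring_hom Qfix M"
    using f by (simp only: ring_hom_def mem_Collect_eq fixed_pair_simps subset_iff) blast
  moreover have "?f (c \<odot>\<^bsub>Qfix\<^esub> x) = c \<odot>\<^bsub>M\<^esub> ?f x" if c: "c \<in> carrier R" and x: "x \<in> carrier Qfix" for c x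
  proof -
    from x obtain a b where "x = (a, b)" "a \<in> carrier M" "b \<in> carrier M"
      by (auto simp: fixed_pair_simps fixed_set_def)
    then show ?thesis using c s by (simp add: fixed_pair_simps smult_eq_base_map r_distr m_ac)
  qed
  ultimately have "?f \<in> alg_iso R Qfix M"
    using split_bij[OF two su] by (simp add: alg_iso_def alg_hom_def fixed_pair_simps(1))
  then show ?thesis using alg_iso_comp[OF \<phi>_alg_iso] by blast
qed

section \<open>Scalar extension of the isomorphism\<close>

abbreviation "sqrt_t \<equiv> (\<zero>\<^bsub>M\<^esub>, \<one>\<^bsub>M\<^esub>)"

text \<open>The scalar extension of \<phi> in pair coordinates, where the pair (X, Y) stands for X +
  Y x; the map \<Psi> on classes is deduced from it.\<close>

definition "\<Psi>\<^sub>0 = (\<lambda>(X, Y). \<phi> X \<oplus>\<^bsub>Q\<^esub> sqrt_t \<otimes>\<^bsub>Q\<^esub> \<phi> Y)"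

lemma CA_quad_algebra: "quad_algebra R CA t"
  by (intro quad_algebra.intro CA_algebra quad_algebra_axioms.intro t_closed)

lemma \<phi>_hom: "\<phi> \<in> ring_hom CA Q" and \<phi>_bij: "bij_betw \<phi> (carrier CA) (fixed_set Q \<sigma>)"
  and \<phi>_base_map: "c \<in> carrier R \<Longrightarrow> \<phi> (base_map CA c) = (base_map M c, \<zero>\<^bsub>M\<^esub>)"
proof -
  have "fixed_set Q \<sigma> \<subseteq> carrier Q" by (auto simp: fixed_set_def)
  moreover have h: "\<phi> \<in> ring_hom CA Qfix" "\<phi> \<in> alg_hom R CA Qfix" "bij_betw \<phi> (carrier CA) (carrier Qfix)"
    using \<phi>_alg_iso by (auto simp: alg_iso_def alg_hom_def)
  ultimately show "\<phi> \<in> ring_hom CA Q" "bij_betw \<phi> (carrier CA) (fixed_set Q \<sigma>)"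
    by (auto simp only: ring_hom_def mem_Collect_eq fixed_pair_simps subset_iff)
  show "\<phi> (base_map CA c) = (base_map M c, \<zero>\<^bsub>M\<^esub>)" if "c \<in> carrier R"
    using alg_hom_base_map[OF CA_algebra h(2) that] that by (simp add: base_map_def fixed_pair_simps)
qed

lemma \<Psi>\<^sub>0_ring_hom: "\<Psi>\<^sub>0 \<in> ring_hom (quad_pair CA t) Q"
  unfolding \<Psi>\<^sub>0_def
proof (rule quad_algebra.quad_pair_homI[OF CA_quad_algebra quad_pair_cring \<phi>_hom])
  show "sqrt_t \<in> carrier Q" by simp
  show "sqrt_t \<otimes>\<^bsub>Q\<^esub> sqrt_t = \<phi> (base_map CA t)" unfolding \<phi>_base_map[OF t_closed] by simp
qed

lemma \<phi>_fixed: "X \<in> carrier CA \<Longrightarrow> \<exists>a\<in>fixed_set M \<theta>. \<exists>b\<in>anti_fixed_set M \<theta>. \<phi> X = (a, b)"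
proof -
  assume "X \<in> carrier CA"
  then have "\<phi> X \<in> fixed_set Q \<sigma>" using \<phi>_bij unfolding bij_betw_def by blast
  moreover obtain a b where ab: "\<phi> X = (a, b)" by (cases "\<phi> X")
  ultimately show ?thesis unfolding ab fixed_set_pair_iff by blast
qed

text \<open>This is (a + b x) + x (c + d x) with x^2 = t. The factor
  \<open>base_map M \<one>\<close> is kept so that the second coordinate matches
  \<open>split_bij\<close> at the unit 1.\<close>

lemma \<Psi>\<^sub>0_apply:
  assumes "\<phi> X = (a, b)" "\<phi> Y = (c, d)" "a \<in> carrier M" "b \<in> carrier M" "c \<in> carrier M" "d \<in> carrier M"
  shows "\<Psi>\<^sub>0 (X, Y) = (a \<oplus>\<^bsub>M\<^esub> \<tau> \<otimes>\<^bsub>M\<^esub> d, c \<oplus>\<^bsub>M\<^esub> base_map M \<one> \<otimes>\<^bsub>M\<^esub> b)"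
  using assms by (simp add: \<Psi>\<^sub>0_def M.a_comm ring_hom_one[OF base_map_hom])

text \<open>The coordinates decouple: the first determines \<open>a\<close> and \<open>d\<close> by
  \<open>split_bij\<close> at the unit \<open>t\<close>, the second \<open>c\<close> and
  \<open>b\<close> at the unit 1.\<close>

lemma \<Psi>\<^sub>0_bij:
  assumes two: "\<one> \<oplus> \<one> \<in> Units R"
  shows "bij_betw \<Psi>\<^sub>0 (carrier (quad_pair CA t)) (carrier Q)"
proof -
  note bt = split_bij[OF two t_unit]
  note b1 = split_bij[OF two R.Units_one_closed]
  \<comment> \<open>\<open>g\<close> is kept general so that the same extraction serves both
    units.\<close>
  have cancel: "x = x' \<and> y = y'" if "bij_betw (\<lambda>(a, b). g a b) (fixed_set Q \<sigma>) B" "g x y = g x' y'"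
      "x \<in> fixed_set M \<theta>" "y \<in> anti_fixed_set M \<theta>" "x' \<in> fixed_set M \<theta>" "y' \<in> anti_fixed_set M \<theta>"
    for g B x y x' y'
    using that(1) inj_onD[of "\<lambda>(a, b). g a b" "fixed_set Q \<sigma>" "(x, y)" "(x', y')"] that(2-)
    by (simp add: bij_betw_def fixed_set_pair_iff)
  have surj: "\<exists>x y. w = g x y \<and> (x, y) \<in> fixed_set Q \<sigma>"
    if "bij_betw (\<lambda>(a, b). g a b) (fixed_set Q \<sigma>) B" "w \<in> B" for g B w
  proof -
    have "w \<in> (\<lambda>(a, b). g a b) ` fixed_set Q \<sigma>"
      using that(2) unfolding bij_betw_imp_surj_on[OF that(1)] .
    then obtain p where p: "w = (case p of (a, b) \<Rightarrow> g a b)" "p \<in> fixed_set Q \<sigma>"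
      by (rule imageE)
    then show ?thesis by (cases p) auto
  qed
  have "inj_on \<Psi>\<^sub>0 (carrier (quad_pair CA t))"
  proof (rule inj_onI)
    fix u v assume "u \<in> carrier (quad_pair CA t)" "v \<in> carrier (quad_pair CA t)" and eq: "\<Psi>\<^sub>0 u = \<Psi>\<^sub>0 v"
    then obtain X Y X' Y' where XY: "u = (X, Y)" "v = (X', Y')" "X \<in> carrier CA" "Y \<in> carrier CA"
      "X' \<in> carrier CA" "Y' \<in> carrier CA" by auto
    obtain a b c d where 1: "a \<in> fixed_set M \<theta>" "b \<in> anti_fixed_set M \<theta>" "c \<in> fixed_set M \<theta>" "d \<in> anti_fixed_set M \<theta>"
      "\<phi> X = (a, b)" "\<phi> Y = (c, d)" using \<phi>_fixed XY(3,4) by meson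
    obtain a' b' c' d' where 2: "a' \<in> fixed_set M \<theta>" "b' \<in> anti_fixed_set M \<theta>" "c' \<in> fixed_set M \<theta>" "d' \<in> anti_fixed_set M \<theta>"
      "\<phi> X' = (a', b')" "\<phi> Y' = (c', d')" using \<phi>_fixed XY(5,6) by meson
    note cl = fixed_closed
    have e: "a \<oplus>\<^bsub>M\<^esub> \<tau> \<otimes>\<^bsub>M\<^esub> d = a' \<oplus>\<^bsub>M\<^esub> \<tau> \<otimes>\<^bsub>M\<^esub> d'"
      "c \<oplus>\<^bsub>M\<^esub> base_map M \<one> \<otimes>\<^bsub>M\<^esub> b = c' \<oplus>\<^bsub>M\<^esub> base_map M \<one> \<otimes>\<^bsub>M\<^esub> b'"
      using eq \<Psi>\<^sub>0_apply[OF 1(5,6) cl(1)[OF 1(1)] cl(2)[OF 1(2)] cl(1)[OF 1(3)] cl(2)[OF 1(4)]]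
        \<Psi>\<^sub>0_apply[OF 2(5,6) cl(1)[OF 2(1)] cl(2)[OF 2(2)] cl(1)[OF 2(3)] cl(2)[OF 2(4)]]
      unfolding XY by simp_all
    have "a = a' \<and> d = d'" by (rule cancel[OF bt e(1) 1(1,4) 2(1,4)])
    moreover have "c = c' \<and> b = b'" by (rule cancel[OF b1 e(2) 1(3,2) 2(3,2)])
    ultimately have "\<phi> X = \<phi> X'" "\<phi> Y = \<phi> Y'" using 1(5,6) 2(5,6) by simp_all
    moreover have "inj_on \<phi> (carrier CA)" using \<phi>_bij unfolding bij_betw_def by blast
    ultimately have "X = X'" "Y = Y'" using XY(3-6) by (blast dest: inj_onD)+
    then show "u = v" unfolding XY(1,2) by simp
  qed
  moreover have "\<Psi>\<^sub>0 ` carrier (quad_pair CA t) = carrier Q"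
  proof
    show "\<Psi>\<^sub>0 ` carrier (quad_pair CA t) \<subseteq> carrier Q"
      using ring_hom_closed[OF \<Psi>\<^sub>0_ring_hom] by blast
    show "carrier Q \<subseteq> \<Psi>\<^sub>0 ` carrier (quad_pair CA t)"
    proof
      fix w assume "w \<in> carrier Q"
      then obtain u v where w: "w = (u, v)" "u \<in> carrier M" "v \<in> carrier M" by auto
      obtain a d where ad: "u = a \<oplus>\<^bsub>M\<^esub> \<tau> \<otimes>\<^bsub>M\<^esub> d" "(a, d) \<in> fixed_set Q \<sigma>"
        using surj[OF bt w(2)] by blast
      obtain c b where cb: "v = c \<oplus>\<^bsub>M\<^esub> base_map M \<one> \<otimes>\<^bsub>M\<^esub> b" "(c, b) \<in> fixed_set Q \<sigma>"
        using surj[OF b1 w(3)] by blast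
      \<comment> \<open>The pairs (a, d) and (c, b) are regrouped as (a, b) and (c, d). Being fixed
        is a condition on each entry separately, so the new pairs are fixed too and have preimages
        under \<phi>.\<close>
      note ad' = ad(2)[unfolded fixed_set_pair_iff] and cb' = cb(2)[unfolded fixed_set_pair_iff]
      have "(a, b) \<in> fixed_set Q \<sigma>" "(c, d) \<in> fixed_set Q \<sigma>" using ad' cb' unfolding fixed_set_pair_iff by blast+
      then have "(a, b) \<in> \<phi> ` carrier CA" "(c, d) \<in> \<phi> ` carrier CA"
        unfolding bij_betw_imp_surj_on[OF \<phi>_bij] by blast+
      then obtain X Y where XY: "X \<in> carrier CA" "Y \<in> carrier CA" "\<phi> X = (a, b)" "\<phi> Y = (c, d)"
        by (elim imageE) simp
      have "\<Psi>\<^sub>0 (X, Y) = w"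
        unfolding w ad(1) cb(1) by (rule \<Psi>\<^sub>0_apply[OF XY(3,4)]) (use fixed_closed ad' cb' in blast)+
      then show "w \<in> \<Psi>\<^sub>0 ` carrier (quad_pair CA t)" using XY(1,2) by (intro image_eqI[of _ _ "(X, Y)"]) simp_all
    qed
  qed
  ultimately show ?thesis by (simp add: bij_betw_def)
qed

definition "\<Psi> = pelt \<circ> (\<Psi>\<^sub>0 \<circ> inv_into (carrier (quad_pair CA t)) (\<lambda>(X, Y). quad_elt CA t X Y))"

lemma \<Psi>_quad_elt:
  assumes "X \<in> carrier CA" "Y \<in> carrier CA"
  shows "\<Psi> (quad_elt CA t X Y) = pelt (\<Psi>\<^sub>0 (X, Y))"
proof -
  have "inj_on (\<lambda>(X, Y). quad_elt CA t X Y) (carrier (quad_pair CA t))"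
    using quad_algebra.pelt_ring_iso[OF CA_quad_algebra] by (simp add: ring_iso_def bij_betw_def)
  from inv_into_f_f[OF this, of "(X, Y)"] show ?thesis using assms by (simp add: \<Psi>_def)
qed

lemma \<Psi>_ring_iso:
  assumes two: "\<one> \<oplus> \<one> \<in> Units R"
  shows "\<Psi> \<in> ring_iso (quad_ext CA t) (quad_ext M t)"
proof -
  interpret B: quad_algebra R CA t by (rule CA_quad_algebra)
  have "\<Psi>\<^sub>0 \<in> ring_iso (quad_pair CA t) Q"
    using \<Psi>\<^sub>0_ring_hom \<Psi>\<^sub>0_bij[OF two] by (simp add: ring_iso_def)
  moreover have "inv_into (carrier (quad_pair CA t)) B.pelt \<in> ring_iso (quad_ext CA t) (quad_pair CA t)"
    by (rule ring_iso_set_sym[OF cring.axioms(1)[OF B.quad_pair_cring] B.pelt_ring_iso])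
  ultimately show ?thesis
    unfolding \<Psi>_def by (intro ring_iso_set_trans[OF ring_iso_set_trans pelt_ring_iso])
qed

text \<open>Linearity over k[x]/(x^2 - t) amounts to compatibility with the structure maps: \<phi>
  preserves constants, and x goes to x.\<close>

lemma \<Psi>_quad_map:
  assumes "\<alpha> \<in> carrier (quad_ext (self_alg R) t)"
  shows "\<Psi> (quad_map CA t \<alpha>) = quad_map M t \<alpha>"
proof -
  interpret k: quad_algebra R "self_alg R" t by (rule self_alg_quad_algebra)
  interpret B: quad_algebra R CA t by (rule CA_quad_algebra)
  obtain a b where ab: "\<alpha> = quad_elt (self_alg R) t a b" "a \<in> carrier R" "b \<in> carrier R"
    using assms unfolding k.quad_ext_carrier by auto
  show ?thesis
    unfolding ab(1) B.quad_map_quad_elt[OF ab(2,3)] quad_map_quad_elt[OF ab(2,3)]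
      \<Psi>_quad_elt[OF B.base_map_closed[OF ab(2)] B.base_map_closed[OF ab(3)]]
    using ab(2,3) by (simp add: \<Psi>\<^sub>0_def \<phi>_base_map)
qed

lemma \<Psi>_alg_iso:
  assumes two: "\<one> \<oplus> \<one> \<in> Units R"
  shows "\<Psi> \<in> alg_iso (quad_ext (self_alg R) t) (quad_ext_alg CA t) (quad_ext_alg M t)"
proof -
  interpret B: quad_algebra R CA t by (rule CA_quad_algebra)
  have h: "\<Psi> \<in> ring_hom (quad_ext CA t) (quad_ext M t)"
    and b: "bij_betw \<Psi> (carrier (quad_ext CA t)) (carrier (quad_ext M t))"
    using \<Psi>_ring_iso[OF two] by (simp_all only: ring_iso_def mem_Collect_eq)
  have "\<Psi> \<in> ring_hom (quad_ext_alg CA t) (quad_ext_alg M t)"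
    unfolding quad_ext_alg_def alg_via_ring_hom by (rule h)
  moreover have "\<Psi> (\<alpha> \<odot>\<^bsub>quad_ext_alg CA t\<^esub> \<beta>) = \<alpha> \<odot>\<^bsub>quad_ext_alg M t\<^esub> \<Psi> \<beta>"
    if \<alpha>: "\<alpha> \<in> carrier (quad_ext (self_alg R) t)" and \<beta>: "\<beta> \<in> carrier (quad_ext CA t)" for \<alpha> \<beta>
    unfolding quad_ext_alg_def alg_via_simps
    using ring_hom_mult[OF h ring_hom_closed[OF B.quad_map_ring_hom \<alpha>] \<beta>] \<Psi>_quad_map[OF \<alpha>] by (simp only:)
  moreover have "carrier (quad_ext_alg CA t) = carrier (quad_ext CA t)"
    "carrier (quad_ext_alg M t) = carrier (quad_ext M t)" unfolding quad_ext_alg_def alg_via_simps by (rule refl)+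
  ultimately show ?thesis using b by (simp only: alg_iso_def alg_hom_def mem_Collect_eq simp_thms) blast
qed

text \<open>The map from pairs to classes is a ring homomorphism taking (0, 1) to the class of x;
  applied to the formula for \<open>\<Psi>\<^sub>0\<close> it gives the claim.\<close>

lemma \<Psi>_scalar_ext: "is_quad_scalar_ext CA M t (pelt \<circ> \<phi>) \<Psi>"
  unfolding is_quad_scalar_ext_def
proof (intro ballI)
  interpret Q: cring Q by (rule quad_pair_cring)
  fix X Y assume XY: "X \<in> carrier CA" "Y \<in> carrier CA"
  have p: "pelt \<in> ring_hom Q (quad_ext M t)" using pelt_ring_iso by (simp only: ring_iso_def mem_Collect_eq)
  have c: "\<phi> X \<in> carrier Q" "\<phi> Y \<in> carrier Q" "sqrt_t \<in> carrier Q"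
    using ring_hom_closed[OF \<phi>_hom] XY by auto
  have "\<Psi> (quad_elt CA t X Y) = pelt (\<phi> X \<oplus>\<^bsub>Q\<^esub> sqrt_t \<otimes>\<^bsub>Q\<^esub> \<phi> Y)"
    unfolding \<Psi>_quad_elt[OF XY] \<Psi>\<^sub>0_def prod.case ..
  also have "\<dots> = pelt (\<phi> X) \<oplus>\<^bsub>quad_ext M t\<^esub> (pelt sqrt_t \<otimes>\<^bsub>quad_ext M t\<^esub> pelt (\<phi> Y))"
    unfolding ring_hom_add[OF p c(1) Q.m_closed[OF c(3,2)]] ring_hom_mult[OF p c(3,2)] ..
  finally show "\<Psi> (quad_elt CA t X Y) =
      (pelt \<circ> \<phi>) X \<oplus>\<^bsub>quad_ext M t\<^esub> quad_elt M t \<zero>\<^bsub>M\<^esub> \<one>\<^bsub>M\<^esub> \<otimes>\<^bsub>quad_ext M t\<^esub> (pelt \<circ> \<phi>) Y"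
    unfolding comp_apply prod.case .
qed

end

theorem proposition1p1:
  fixes k :: "('c, 'm) ring_scheme"
    and A :: "('c, 'a, 'n) module_scheme"
    and \<theta> :: "'a \<Rightarrow> 'a"
    and t\<^sub>0 :: 'c
  assumes "cring k"
    and "\<one>\<^bsub>k\<^esub> \<oplus>\<^bsub>k\<^esub> \<one>\<^bsub>k\<^esub> \<in> Units k"
    and "algebra k A"
    and "involution k A \<theta>"
    and "t\<^sub>0 \<in> Units k"
  shows "
    (involution k (quad_ext (self_alg k) t\<^sub>0) (quad_inv (self_alg k) t\<^sub>0 (\<lambda>a. a)) \<and>
     (\<forall>a\<in>carrier k. \<forall>b\<in>carrier k.
        quad_inv (self_alg k) t\<^sub>0 (\<lambda>a. a) (quad_elt (self_alg k) t\<^sub>0 a b) =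
        quad_elt (self_alg k) t\<^sub>0 a (\<ominus>\<^bsub>k\<^esub> b)) \<and>
     involution k (quad_ext A t\<^sub>0) (quad_inv A t\<^sub>0 \<theta>) \<and>
     (\<forall>a\<in>carrier A. \<forall>b\<in>carrier A.
        quad_inv A t\<^sub>0 \<theta> (quad_elt A t\<^sub>0 a b) = quad_elt A t\<^sub>0 (\<theta> a) (\<ominus>\<^bsub>A\<^esub> \<theta> b)))
    \<and>
    (quad_map A t\<^sub>0 \<in> alg_hom k (quad_ext (self_alg k) t\<^sub>0) (quad_ext A t\<^sub>0) \<and>
     (\<forall>\<alpha>\<in>carrier (quad_ext (self_alg k) t\<^sub>0).
        quad_map A t\<^sub>0 (quad_inv (self_alg k) t\<^sub>0 (\<lambda>a. a) \<alpha>) =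
        quad_inv A t\<^sub>0 \<theta> (quad_map A t\<^sub>0 \<alpha>)) \<and>
     (\<forall>\<alpha>\<in>carrier (quad_ext (self_alg k) t\<^sub>0). \<forall>\<beta>\<in>carrier (quad_ext A t\<^sub>0).
        quad_inv A t\<^sub>0 \<theta> (quad_map A t\<^sub>0 \<alpha> \<otimes>\<^bsub>quad_ext A t\<^sub>0\<^esub> \<beta>) =
        quad_map A t\<^sub>0 (quad_inv (self_alg k) t\<^sub>0 (\<lambda>a. a) \<alpha>)
          \<otimes>\<^bsub>quad_ext A t\<^sub>0\<^esub> quad_inv A t\<^sub>0 \<theta> \<beta>))
    \<and>
    (\<exists>\<psi> \<in> alg_iso k (contraction_at k A \<theta> t\<^sub>0) (fixed_alg (quad_ext A t\<^sub>0) (quad_inv A t\<^sub>0 \<theta>)).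
     \<exists>\<Psi> \<in> alg_iso (quad_ext (self_alg k) t\<^sub>0)
             (quad_ext_alg (contraction_at k A \<theta> t\<^sub>0) t\<^sub>0) (quad_ext_alg A t\<^sub>0).
       is_quad_scalar_ext (contraction_at k A \<theta> t\<^sub>0) A t\<^sub>0 \<psi> \<Psi>)
    \<and>
    ((\<exists>s\<in>carrier k. s \<otimes>\<^bsub>k\<^esub> s = t\<^sub>0) \<longrightarrow>
     (\<exists>h. h \<in> alg_iso k (contraction_at k A \<theta> t\<^sub>0) A))"
proof -
  interpret k: cring k by fact
  have t: "t\<^sub>0 \<in> carrier k" using assms(5) by (rule k.Units_closed)
  interpret A: involutive_quad_algebra k A t\<^sub>0 \<theta>
    by (intro involutive_quad_algebra.intro quad_algebra.intro quad_algebra_axioms.intro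
        involutive_quad_algebra_axioms.intro assms t)
  interpret K: quad_algebra k "self_alg k" t\<^sub>0 by (rule A.self_alg_quad_algebra)
  \<comment> \<open>The involution of k[x]/(x^2 - \<open>t\<^sub>0\<close>) is the general
    construction for the identity involution of \<open>k\<close>.\<close>
  have idk: "involution k (self_alg k) (\<lambda>a. a)"
    by (auto simp: involution_def alg_iso_def alg_hom_def ring_hom_def bij_betw_def)
  have map_hom: "quad_map A t\<^sub>0 \<in> ring_hom (quad_ext (self_alg k) t\<^sub>0) (quad_ext A t\<^sub>0)"
    by (rule A.quad_map_ring_hom)
  note inv = quad_inv_involution[OF A.quad_algebra_axioms assms(4)]
  have inv_hom: "quad_inv A t\<^sub>0 \<theta> \<in> ring_hom (quad_ext A t\<^sub>0) (quad_ext A t\<^sub>0)"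
    using inv(1) by (simp only: involution_def alg_iso_def alg_hom_def mem_Collect_eq)
  \<comment> \<open>The second form of (1) follows from the first by multiplicativity of the
    involution on the extension of \<open>A\<close>.\<close>
  have semilinear: "quad_inv A t\<^sub>0 \<theta> (quad_map A t\<^sub>0 \<alpha> \<otimes>\<^bsub>quad_ext A t\<^sub>0\<^esub> \<beta>) =
      quad_map A t\<^sub>0 (quad_inv (self_alg k) t\<^sub>0 (\<lambda>a. a) \<alpha>) \<otimes>\<^bsub>quad_ext A t\<^sub>0\<^esub> quad_inv A t\<^sub>0 \<theta> \<beta>"
    if "\<alpha> \<in> carrier (quad_ext (self_alg k) t\<^sub>0)" "\<beta> \<in> carrier (quad_ext A t\<^sub>0)" for \<alpha> \<beta>
    unfolding A.quad_map_quad_inv[OF assms(4) that(1)]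
    by (rule ring_hom_mult[OF inv_hom ring_hom_closed[OF map_hom that(1)] that(2)])
  have K_elt: "quad_inv (self_alg k) t\<^sub>0 (\<lambda>a. a) (quad_elt (self_alg k) t\<^sub>0 a b) =
      quad_elt (self_alg k) t\<^sub>0 a (\<ominus>\<^bsub>k\<^esub> b)" if "a \<in> carrier k" "b \<in> carrier k" for a b
    using K.quad_inv_quad_elt[of a b "\<lambda>a. a"] that by simp
  have iso: "(\<lambda>(a, b). quad_elt A t\<^sub>0 a b) \<circ> A.\<phi> \<in>
      alg_iso k (contraction_at k A \<theta> t\<^sub>0) (fixed_alg (quad_ext A t\<^sub>0) (quad_inv A t\<^sub>0 \<theta>))"
    by (rule alg_iso_comp[OF A.\<phi>_alg_iso inv(2)])
  show ?thesis
    by (intro conjI ballI impI)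
      (fact quad_inv_involution(1)[OF K.quad_algebra_axioms idk] K_elt inv(1) A.quad_inv_quad_elt
        A.quad_map_alg_hom A.quad_map_quad_inv[OF assms(4)] semilinear
      | rule bexI[OF _ iso] bexI[OF _ A.\<Psi>_alg_iso[OF assms(2)]] A.\<Psi>_scalar_ext
      | use A.sqrt_alg_iso[OF assms(2)] in blast)+
qed

end
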